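(* No probabilistic algorithm can produce, with positive probability, an infinite binary sequence $\omega$ that is $\alpha$-everywhere complex for some $\alpha\in(0,1)$. That is, for every probabilistic algorithm $A$, the probability (over the random bits used by $A$) of the event "the output of $A$ is an infinite binary sequence $\omega$, and there exist $\alpha\in(0,1)$ and a constant $c$ such that $K(\omega([k,k+n)))\ge \alpha n-c$ for all natural numbers $k,n$" is equal to $0$.
   Context: A probabilistic algorithm is an algorithm that has access to a source of independent fair random bits and outputs binary digits one after another; with some probability it may output only finitely many bits. For an infinite binary sequence $\omega=\omega_0\omega_1\omega_2\dots$, $\omega([i,j))$ denotes the substring $\omega_i\omega_{i+1}\dots\omega_{j-1}$. $K(u)$ denotes the Kolmogorov complexity of a binary string $u$ (the minimal length of a program producing $u$ with respect to a fixed optimal decompressor). A sequence $\omega$ is called $\alpha$-everywhere complex if there is a constant $c$ such that $K(\omega([k,k+n)))\ge\alpha n-c$ for all integers $k,n\ge 0$. *)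

theory Defs
  imports "HOL-Probability.Probability" "HOL-Library.Nat_Bijection"
begin

datatype recf =
    Zero
  | Succ
  | Proj nat
  | Comp recf "recf list"
  | PrimRec recf recf
  | Minim recf

inductive eval :: "recf \<Rightarrow> nat list \<Rightarrow> nat \<Rightarrow> bool" where
  eval_Zero: "eval Zero xs 0"
| eval_Succ: "eval Succ (x # xs) (Suc x)"
| eval_Proj: "i < length xs \<Longrightarrow> eval (Proj i) xs (xs ! i)"
| eval_Comp: "list_all2 (\<lambda>g y. eval g xs y) gs ys \<Longrightarrow> eval f ys z \<Longrightarrow> eval (Comp f gs) xs z"
| eval_PrimRec0: "eval f xs y \<Longrightarrow> eval (PrimRec f g) (0 # xs) y"
| eval_PrimRecS: "eval (PrimRec f g) (n # xs) y \<Longrightarrow> eval g (n # y # xs) z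
                   \<Longrightarrow> eval (PrimRec f g) (Suc n # xs) z"
| eval_Minim: "eval f (n # xs) 0 \<Longrightarrow> (\<forall>m<n. \<exists>y. y \<noteq> 0 \<and> eval f (m # xs) y)
                \<Longrightarrow> eval (Minim f) xs n"

definition computable :: "(nat \<Rightarrow> nat) \<Rightarrow> bool" where
  "computable g \<longleftrightarrow> (\<exists>f. \<forall>x y. eval f [x] y \<longleftrightarrow> g x = y)"

text \<open>Binary strings are coded by naturals (bijective base-2 numeration).\<close>
fun str_code :: "bool list \<Rightarrow> nat" where
  "str_code [] = 0"
| "str_code (b # bs) = 2 * str_code bs + (if b then 2 else 1)"

definition decompressor :: "(bool list \<Rightarrow> bool list option) \<Rightarrow> bool" where
  "decompressor D \<longleftrightarrow>
     (\<exists>f. \<forall>p u. eval f [str_code p] (str_code u) \<longleftrightarrow> D p = Some u)"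

definition optimal_decompressor :: "(bool list \<Rightarrow> bool list option) \<Rightarrow> bool" where
  "optimal_decompressor D \<longleftrightarrow> decompressor D \<and>
     (\<forall>E. decompressor E \<longrightarrow> (\<exists>c. \<forall>p u. E p = Some u \<longrightarrow>
          (\<exists>q. D q = Some u \<and> length q \<le> length p + c)))"

definition KC :: "(bool list \<Rightarrow> bool list option) \<Rightarrow> bool list \<Rightarrow> nat" where
  "KC D u = (LEAST n. \<exists>p. length p = n \<and> D p = Some u)"

definition substr :: "(nat \<Rightarrow> bool) \<Rightarrow> nat \<Rightarrow> nat \<Rightarrow> bool list" where
  "substr \<omega> k n = map \<omega> [k..<k+n]"

definition everywhere_complex :: "(bool list \<Rightarrow> bool list option) \<Rightarrow> real \<Rightarrow> (nat \<Rightarrow> bool) \<Rightarrow> bool" where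
  "everywhere_complex D \<alpha> \<omega> \<longleftrightarrow>
     (\<exists>c::real. \<forall>k n. real (KC D (substr \<omega> k n)) \<ge> \<alpha> * real n - c)"

text \<open>A probabilistic algorithm is a machine with states in nat (start state 0) whose
  instruction in state s is given by the computable (total) transition function delta.
  Decoding of v = delta s, with w = v div 4:
   v mod 4 = 0: halt;
   v mod 4 = 1: internal step to state w;
   v mod 4 = 2: output bit (odd w), go to state w div 2;
   v mod 4 = 3: read the next random bit b, go to state fst (prod_decode w) if b is False,
                snd (prod_decode w) if b is True.
  A configuration is (state, number of random bits read, output produced so far).\<close>
fun pstep :: "(nat \<Rightarrow> nat) \<Rightarrow> (nat \<Rightarrow> bool) \<Rightarrow> nat \<times> nat \<times> bool list \<Rightarrow> nat \<times> nat \<times> bool list" where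
  "pstep \<delta> \<rho> (s, i, out) =
     (let v = \<delta> s; w = v div 4 in
      if v mod 4 = 0 then (s, i, out)
      else if v mod 4 = 1 then (w, i, out)
      else if v mod 4 = 2 then (w div 2, i, out @ [odd w])
      else ((if \<rho> i then snd (prod_decode w) else fst (prod_decode w)), Suc i, out))"

definition pconfig :: "(nat \<Rightarrow> nat) \<Rightarrow> (nat \<Rightarrow> bool) \<Rightarrow> nat \<Rightarrow> nat \<times> nat \<times> bool list" where
  "pconfig \<delta> \<rho> t = (pstep \<delta> \<rho> ^^ t) (0, 0, [])"

definition poutput :: "(nat \<Rightarrow> nat) \<Rightarrow> (nat \<Rightarrow> bool) \<Rightarrow> nat \<Rightarrow> bool list" where
  "poutput \<delta> \<rho> t = snd (snd (pconfig \<delta> \<rho> t))"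

definition produces :: "(nat \<Rightarrow> nat) \<Rightarrow> (nat \<Rightarrow> bool) \<Rightarrow> (nat \<Rightarrow> bool) \<Rightarrow> bool" where
  "produces \<delta> \<rho> \<omega> \<longleftrightarrow> (\<forall>n. \<exists>t. n < length (poutput \<delta> \<rho> t) \<and> poutput \<delta> \<rho> t ! n = \<omega> n)"

definition coin_space :: "(nat \<Rightarrow> bool) measure" where
  "coin_space = PiM UNIV (\<lambda>_. measure_pmf (bernoulli_pmf (1/2)))"

end

(* Fix a >= 1/alpha, a constant c and K = 4a. Suppose we have a list F of strings whose j-th member
   has length at least K log (m + j), such that the output of the algorithm has a factor in F with
   probability close to the probability p of infinite output. Given m and a rational number slightly
   below p, such an F can be found by exhaustive search, so its j-th member has a description of
   length about 2 log (m + j), too short for an alpha-everywhere complex sequence once m is large. As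
   outputs with a factor in F are long, up to a small probability they are infinite; hence almost all
   infinite outputs have a factor that is too simple.

   Such an F exists for every distribution on long sequences: a sequence with many distinct blocks of
   some length n is hit by a moderate number of greedily chosen blocks, and a sequence with few
   distinct blocks has, at a much larger block length, an alphabet of smaller entropy rate. After
   finitely many rounds the whole alphabet fits into F. *)

theory Submission
  imports Defs "HOL-Library.Sublist"
begin

section \<open>Recursive functions\<close>

text \<open>Since \<open>\<alpha>\<close>-everywhere complex sequences exist, the argument cannot
  work sequence by sequence; what it exploits is that a program can tabulate the output distribution
  up to any time t. The probability p of infinite output need not be computable, so the search is
  handed a rational lower bound. This makes the decompressor depend on the error
  \<open>\<epsilon>\<close>, and with it the constant lost in passing to the optimal decompressor.
  One decompressor therefore serves all m, and m is chosen only after that constant is known. A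
  second order of choices shapes the combinatorial part: the prefix length N in which F must produce
  hits has to be fixed before the distribution is known, because the time t that yields the
  distribution is chosen so late that most infinite outputs have already reached length N.\<close>

text \<open>The closure lemmas below only construct evaluations with a given value; uniqueness
  supplies the converse half of the equivalence demanded of a decompressor.\<close>

lemma eval_det: "eval f xs y \<Longrightarrow> eval f xs y' \<Longrightarrow> y = y'"
proof (induction arbitrary: y' rule: eval.induct)
  case (eval_Zero xs)
  then show ?case by (cases rule: eval.cases) auto
next
  case (eval_Succ x xs)
  then show ?case by (cases rule: eval.cases) auto
next
  case (eval_Proj i xs)
  from eval_Proj(2) show ?case by (cases rule: eval.cases) auto
next
  case (eval_Comp xs gs ys f z)
  from eval_Comp.prems obtain ys' where ys': "list_all2 (\<lambda>g y. eval g xs y) gs ys'" "eval f ys' y'"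
    by (cases rule: eval.cases) auto
  have "ys = ys'"
    using eval_Comp.IH(1) ys'(1) unfolding list_all2_conv_all_nth
    by (intro nth_equalityI) auto
  with ys' eval_Comp.IH(2) show ?case by blast
next
  case (eval_PrimRec0 f xs y g)
  from eval_PrimRec0.prems have "eval f xs y'" by (cases rule: eval.cases) auto
  with eval_PrimRec0.IH show ?case by blast
next
  case (eval_PrimRecS f g n xs y z)
  from eval_PrimRecS.prems obtain y1 where "eval (PrimRec f g) (n # xs) y1" "eval g (n # y1 # xs) y'"
    by (cases rule: eval.cases) auto
  with eval_PrimRecS.IH show ?case by blast
next
  case (eval_Minim f n xs)
  from eval_Minim.prems have n': "eval f (y' # xs) 0" "\<forall>m<y'. \<exists>y. y \<noteq> 0 \<and> eval f (m # xs) y"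
    by (cases rule: eval.cases; auto)+
  show ?case
  proof (rule linorder_cases[of n y'])
    assume "n < y'"
    with n'(2) obtain y where "y \<noteq> 0" "eval f (n # xs) y" by blast
    with eval_Minim.IH(1) show ?thesis by force
  next
    assume "y' < n"
    with eval_Minim.IH(2) n'(1) show ?thesis by force
  qed
qed

text \<open>The arity \<open>k\<close> is explicit because the list argument of \<^const>\<open>eval\<close> carries no
  arity; nothing is claimed about lists of other lengths.\<close>

definition recursive :: "nat \<Rightarrow> (nat list \<Rightarrow> nat) \<Rightarrow> bool" where
  "recursive k f \<longleftrightarrow> (\<exists>r. \<forall>xs. length xs = k \<longrightarrow> eval r xs (f xs))"

lemma recursive_cong:
  "(\<And>xs. length xs = k \<Longrightarrow> f xs = g xs) \<Longrightarrow> recursive k f \<longleftrightarrow> recursive k g"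
  unfolding recursive_def by simp

lemma recursive_comp:
  assumes "recursive (length gs) f" and "\<And>g. g \<in> set gs \<Longrightarrow> recursive k g"
  shows "recursive k (\<lambda>xs. f (map (\<lambda>g. g xs) gs))"
proof -
  obtain r where r: "\<And>ys. length ys = length gs \<Longrightarrow> eval r ys (f ys)"
    using assms(1) unfolding recursive_def by blast
  have "\<forall>g \<in> set gs. \<exists>p. \<forall>xs. length xs = k \<longrightarrow> eval p xs (g xs)"
    using assms(2) unfolding recursive_def by blast
  then obtain p where p: "\<And>g xs. g \<in> set gs \<Longrightarrow> length xs = k \<Longrightarrow> eval (p g) xs (g xs)"
    by metis
  have "eval (Comp r (map p gs)) xs (f (map (\<lambda>g. g xs) gs))" if "length xs = k" for xs
    by (rule eval_Comp[OF _ r]) (auto simp: list_all2_conv_all_nth p that)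
  then show ?thesis unfolding recursive_def by blast
qed

lemma recursive_nth: "i < k \<Longrightarrow> recursive k (\<lambda>xs. xs ! i)"
  unfolding recursive_def by (rule exI[of _ "Proj i"]) (auto intro: eval_Proj)

lemma recursive_comp1:
  assumes "recursive 1 (\<lambda>ys. h (ys ! 0))" "recursive k a"
  shows "recursive k (\<lambda>xs. h (a xs))"
  using recursive_comp[of "[a]" "\<lambda>ys. h (ys ! 0)" k] assms by simp

lemma recursive_computable:
  assumes "computable f" "recursive k a"
  shows "recursive k (\<lambda>xs. f (a xs))"
proof (rule recursive_comp1[OF _ assms(2)])
  obtain r where "\<And>x. eval r [x] (f x)"
    using assms(1) unfolding computable_def by blast
  then have "\<forall>ys. length ys = 1 \<longrightarrow> eval r ys (f (ys ! 0))"
    by (auto simp: length_Suc_conv)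
  then show "recursive 1 (\<lambda>ys. f (ys ! 0))" unfolding recursive_def by blast
qed

lemma recursive_Suc: "recursive k a \<Longrightarrow> recursive k (\<lambda>xs. Suc (a xs))"
  by (rule recursive_comp1[of Suc])
     (auto simp: recursive_def length_Suc_conv intro!: exI[of _ Succ] eval_Succ)

lemma recursive_const: "recursive k (\<lambda>_. c)"
proof (induction c)
  case 0
  show ?case unfolding recursive_def using eval_Zero by blast
qed (rule recursive_Suc)

lemma recursive_cons:
  assumes "recursive (Suc k) F" "recursive k a"
  shows "recursive k (\<lambda>xs. F (a xs # xs))"
proof -
  have "recursive k (\<lambda>xs. F (map (\<lambda>g. g xs) (a # map (\<lambda>i xs. xs ! i) [0..<k])))"
    by (rule recursive_comp) (use assms in \<open>auto intro: recursive_nth\<close>)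
  then show ?thesis
    by (rule recursive_cong[THEN iffD1, rotated]) (auto simp: comp_def intro!: arg_cong[of _ _ F] map_nth)
qed

lemma recursive_tl:
  assumes "recursive k f"
  shows "recursive (Suc k) (\<lambda>xs. f (tl xs))"
proof -
  have "recursive (Suc k) (\<lambda>xs. f (map (\<lambda>g. g xs) (map (\<lambda>i xs. xs ! Suc i) [0..<k])))"
    by (rule recursive_comp) (use assms in \<open>auto intro: recursive_nth\<close>)
  moreover have "map (\<lambda>g. g xs) (map (\<lambda>i xs. xs ! Suc i) [0..<k]) = tl xs"
    if "length xs = Suc k" for xs :: "nat list"
    using that by (intro nth_equalityI) (auto simp: nth_tl)
  ultimately show ?thesis
    by (subst recursive_cong) auto
qed

lemma recursive_hd: "recursive (Suc k) hd"
  by (subst recursive_cong[of _ _ "\<lambda>xs. xs ! 0"])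
     (auto intro: recursive_nth simp: length_Suc_conv)

text \<open>Argument lists act as de Bruijn contexts: under a binder the bound value is pushed onto
  the list, \<open>hd\<close> reads it, and outer terms are lifted by \<open>tl\<close>. Here index
  and accumulator are pushed, in the order in which \<open>PrimRec\<close> passes them.\<close>

lemma recursive_rec_nat:
  assumes n: "recursive k n" and z: "recursive k z"
    and s: "recursive (Suc (Suc k)) (\<lambda>ys. s (hd ys) (hd (tl ys)) (tl (tl ys)))"
  shows "recursive k (\<lambda>xs. rec_nat (z xs) (\<lambda>i y. s i y xs) (n xs))"
proof -
  obtain p where p: "\<And>xs. length xs = k \<Longrightarrow> eval p xs (z xs)"
    using z unfolding recursive_def by blast
  obtain q where "\<forall>ys. length ys = Suc (Suc k) \<longrightarrow> eval q ys (s (hd ys) (hd (tl ys)) (tl (tl ys)))"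
    using s unfolding recursive_def by blast
  then have q: "eval q (i # y # xs) (s i y xs)" if "length xs = k" for i y xs
    using that by (metis length_Cons list.sel)
  have "eval (PrimRec p q) (m # xs) (rec_nat (z xs) (\<lambda>i y. s i y xs) m)" if "length xs = k" for m xs
    by (induction m) (auto intro: eval_PrimRec0 eval_PrimRecS p q that)
  then have "\<forall>ys. length ys = Suc k \<longrightarrow>
      eval (PrimRec p q) ys (rec_nat (z (tl ys)) (\<lambda>i y. s i y (tl ys)) (hd ys))"
    by (auto simp: length_Suc_conv)
  then have "recursive (Suc k) (\<lambda>ys. rec_nat (z (tl ys)) (\<lambda>i y. s i y (tl ys)) (hd ys))"
    unfolding recursive_def by blast
  from recursive_cons[OF this n] show ?thesis by simp
qed

lemma recursive_funpow:
  assumes "recursive k n" "recursive k z" "recursive (Suc k) (\<lambda>ys. f (tl ys) (hd ys))"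
  shows "recursive k (\<lambda>xs. (f xs ^^ n xs) (z xs))"
proof -
  have *: "rec_nat z (\<lambda>i y. f xs y) m = (f xs ^^ m) z" for xs m z
    by (induction m) auto
  have "recursive k (\<lambda>xs. rec_nat (z xs) (\<lambda>i y. f xs y) (n xs))"
    by (rule recursive_rec_nat[where s = "\<lambda>i y xs. f xs y"])
       (fact assms recursive_tl[OF assms(3)])+
  then show ?thesis unfolding * .
qed

lemma recursive_add:
  assumes "recursive k a" "recursive k b" shows "recursive k (\<lambda>xs. a xs + b xs)"
proof -
  have "recursive k (\<lambda>xs. (Suc ^^ b xs) (a xs))"
    by (intro recursive_funpow assms recursive_Suc recursive_const recursive_hd recursive_tl)
  then show ?thesis by (simp add: add.commute)
qed

lemma recursive_sum:
  assumes n: "recursive k n" and f: "recursive (Suc k) (\<lambda>ys. f (hd ys) (tl ys))"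
  shows "recursive k (\<lambda>xs. \<Sum>i<n xs. f i xs)"
proof -
  have *: "rec_nat 0 (\<lambda>i y. y + f i xs) m = (\<Sum>i<m. f i xs)" for xs m
    by (induction m) auto
  \<comment> \<open>The step of the recursion sees index, accumulator and context; the summand has
    to skip the accumulator in second place.\<close>
  have "recursive (Suc (Suc k)) (\<lambda>ys. f (hd ys) (tl (tl ys)))"
  proof -
    have "recursive (Suc (Suc k)) (\<lambda>ys. (\<lambda>zs. f (hd zs) (tl zs))
       (map (\<lambda>g. g ys) ((\<lambda>xs. xs ! 0) # map (\<lambda>i xs. xs ! Suc (Suc i)) [0..<k])))"
      by (rule recursive_comp) (use f in \<open>auto intro: recursive_nth\<close>)
    moreover have "map (\<lambda>g. g xs) ((\<lambda>xs. xs ! 0) # map (\<lambda>i xs. xs ! Suc (Suc i)) [0..<k])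
        = hd xs # tl (tl xs)"
      if "length xs = Suc (Suc k)" for xs :: "nat list"
      using that by (auto simp: length_Suc_conv map_upt_Suc intro!: nth_equalityI)
    ultimately show ?thesis
      by (subst recursive_cong) auto
  qed
  then have "recursive k (\<lambda>xs. rec_nat 0 (\<lambda>i y. y + f i xs) (n xs))"
    by (intro recursive_rec_nat[where s = "\<lambda>i y xs. y + f i xs"] n recursive_const recursive_add
        recursive_tl[OF recursive_hd])
  then show ?thesis unfolding * .
qed

lemma recursive_diff:
  assumes "recursive k a" "recursive k b" shows "recursive k (\<lambda>xs. a xs - b xs)"
proof -
  have pred: "recursive k' (\<lambda>xs. c xs - 1)" if "recursive k' c" for k' c
  proof -
    have *: "rec_nat 0 (\<lambda>i y. i) (c xs) = c xs - 1" for xs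
      by (cases "c xs") auto
    have "recursive k' (\<lambda>xs. rec_nat 0 (\<lambda>i y. i) (c xs))"
      by (intro recursive_rec_nat that recursive_const recursive_hd)
    then show ?thesis unfolding * .
  qed
  have *: "((\<lambda>y. y - 1) ^^ n) m = m - n" for m n :: nat
    by (induction n) auto
  have "recursive k (\<lambda>xs. ((\<lambda>y. y - 1) ^^ (b xs)) (a xs))"
    by (intro recursive_funpow assms pred recursive_const recursive_hd recursive_tl)
  then show ?thesis unfolding * .
qed

lemma recursive_mult:
  assumes "recursive k a" "recursive k b" shows "recursive k (\<lambda>xs. a xs * b xs)"
proof -
  have "recursive k (\<lambda>xs. \<Sum>i<a xs. b xs)"
    by (intro recursive_sum assms recursive_tl)
  then show ?thesis by simp
qed

lemma recursive_power:
  assumes "recursive k a" "recursive k b" shows "recursive k (\<lambda>xs. a xs ^ b xs)"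
proof -
  have *: "((*) m ^^ n) 1 = m ^ n" for m n :: nat
    by (induction n) auto
   have "recursive k (\<lambda>xs. ((*) (a xs) ^^ b xs) 1)"
    by (intro recursive_funpow recursive_mult assms recursive_const recursive_hd recursive_tl)
  then show ?thesis unfolding * .
qed

section \<open>Decidable predicates, bounded search and division\<close>

abbreviation decidable :: "nat \<Rightarrow> (nat list \<Rightarrow> bool) \<Rightarrow> bool" where
  "decidable k P \<equiv> recursive k (\<lambda>xs. of_bool (P xs))"

lemma decidable_le:
  assumes "recursive k a" "recursive k b" shows "decidable k (\<lambda>xs. a xs \<le> b xs)"
proof -
  have *: "of_bool (m \<le> n) = 1 - (m - n)" for m n :: nat by auto
  show ?thesis unfolding * by (intro recursive_diff recursive_const assms)
qed

lemma decidable_conj: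
  assumes "decidable k P" "decidable k Q" shows "decidable k (\<lambda>xs. P xs \<and> Q xs)"
  using recursive_mult[OF assms] by (simp add: of_bool_conj)

lemma decidable_not:
  assumes "decidable k P" shows "decidable k (\<lambda>xs. \<not> P xs)"
proof -
  have "recursive k (\<lambda>xs. 1 - of_bool (P xs))"
    by (intro recursive_diff recursive_const assms)
  also have "(\<lambda>xs. (1 :: nat) - of_bool (P xs)) = (\<lambda>xs. of_bool (\<not> P xs))" by auto
  finally show ?thesis .
qed

lemma decidable_eq:
  assumes "recursive k a" "recursive k b" shows "decidable k (\<lambda>xs. a xs = b xs)"
  unfolding order.eq_iff by (intro decidable_conj decidable_le assms)

lemma decidable_bex:
  assumes "recursive k n" "decidable (Suc k) (\<lambda>ys. P (hd ys) (tl ys))"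
  shows "decidable k (\<lambda>xs. \<exists>i<n xs. P i xs)"
proof -
  have *: "1 \<le> (\<Sum>i<n xs. (of_bool (P i xs) :: nat)) \<longleftrightarrow> (\<exists>i<n xs. P i xs)" for xs
    by (auto simp: Suc_le_eq card_gt_0_iff)
  have "decidable k (\<lambda>xs. 1 \<le> (\<Sum>i<n xs. (of_bool (P i xs) :: nat)))"
    by (intro decidable_le recursive_sum recursive_const assms)
  then show ?thesis unfolding * .
qed

lemma decidable_ball:
  assumes "recursive k n" "decidable (Suc k) (\<lambda>ys. P (hd ys) (tl ys))"
  shows "decidable k (\<lambda>xs. \<forall>i<n xs. P i xs)"
proof -
  have "decidable k (\<lambda>xs. \<not> (\<exists>i<n xs. \<not> P i xs))"
    by (intro decidable_not decidable_bex assms)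
  then show ?thesis by simp
qed

lemma recursive_if:
  assumes "decidable k P" "recursive k a" "recursive k b"
  shows "recursive k (\<lambda>xs. if P xs then a xs else b xs)"
proof -
  have *: "of_bool (P xs) * a xs + of_bool (\<not> P xs) * b xs = (if P xs then a xs else b xs)" for xs
    by simp
  have "recursive k (\<lambda>xs. of_bool (P xs) * a xs + of_bool (\<not> P xs) * b xs)"
    by (intro recursive_add recursive_mult decidable_not assms)
  then show ?thesis unfolding * .
qed

lemma recursive_div:
  assumes "recursive k a" "recursive k b" shows "recursive k (\<lambda>xs. a xs div b xs)"
proof -
  \<comment> \<open>The quotient is the number of \<open>q\<close> with
    \<open>(q + 1) * n \<le> m\<close>. For \<open>n = 0\<close> every \<open>q < m\<close> would be
    counted, so the first factor enforces \<open>m div 0 = 0\<close>.\<close>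
  have *: "of_bool (1 \<le> n) * (\<Sum>q<m. of_bool ((q + 1) * n \<le> m)) = m div n" for m n :: nat
  proof (cases "n = 0")
    case False
    have "{q. q < m \<and> (q + 1) * n \<le> m} = {..<m div n}"
    proof (intro set_eqI)
      fix q
      have "Suc q * n \<le> m \<Longrightarrow> q < m"
        using False by (cases n) auto
      then show "q \<in> {q. q < m \<and> (q + 1) * n \<le> m} \<longleftrightarrow> q \<in> {..<m div n}"
        using False less_eq_div_iff_mult_less_eq[of n "Suc q" m] by (auto simp: Suc_le_eq)
    qed
    then have "(\<Sum>q<m. of_bool ((q + 1) * n \<le> m)) = m div n"
      by (simp add: of_bool_def sum.If_cases Int_def)
    with False show ?thesis by simp
  qed simp
  have "recursive k (\<lambda>xs. of_bool (1 \<le> b xs) * (\<Sum>q<a xs. of_bool ((q + 1) * b xs \<le> a xs)))"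
    by (intro recursive_mult recursive_sum decidable_le recursive_add recursive_const recursive_tl
        recursive_hd assms)
  then show ?thesis unfolding * .
qed

lemma recursive_mod:
  assumes "recursive k a" "recursive k b" shows "recursive k (\<lambda>xs. a xs mod b xs)"
  unfolding minus_div_mult_eq_mod[symmetric]
  by (intro recursive_diff recursive_div recursive_mult assms)

lemma decidable_odd: "recursive k a \<Longrightarrow> decidable k (\<lambda>xs. odd (a xs))"
  unfolding mod_2_eq_odd[symmetric] by (intro recursive_mod recursive_const)

lemma recursive_prod_encode:
  assumes "recursive k a" "recursive k b" shows "recursive k (\<lambda>xs. prod_encode (a xs, b xs))"
  unfolding prod_encode_def triangle_def
  unfolding split_conv
  by (intro recursive_add recursive_div recursive_mult recursive_const recursive_Suc assms)

abbreviation nfst :: "nat \<Rightarrow> nat" where "nfst x \<equiv> fst (prod_decode x)"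
abbreviation nsnd :: "nat \<Rightarrow> nat" where "nsnd x \<equiv> snd (prod_decode x)"

text \<open>Both components of a pair are at most its code, so decoding is a bounded search, written
  as a double sum to which only the right pair contributes.\<close>

lemma recursive_prod_decode:
  assumes a: "recursive k a"
  shows "recursive k (\<lambda>xs. nfst (a xs))" "recursive k (\<lambda>xs. nsnd (a xs))"
proof -
  have *: "(\<Sum>i<Suc z. \<Sum>j<Suc z. f i j * of_bool (prod_encode (i, j) = z))
         = f (nfst z) (nsnd z)" for z :: nat and f :: "nat \<Rightarrow> nat \<Rightarrow> nat"
  proof -
    have le: "nfst z < Suc z" "nsnd z < Suc z"
      by (metis le_imp_less_Suc le_prod_encode_1 prod_decode_inverse prod.collapse)
         (metis le_imp_less_Suc le_prod_encode_2 prod_decode_inverse prod.collapse)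
    have "prod_encode (i, j) = z \<longleftrightarrow> i = nfst z \<and> j = nsnd z" for i j
      by (metis fst_conv prod.collapse prod_decode_inverse prod_encode_inverse snd_conv)
    then have "(\<Sum>i<Suc z. \<Sum>j<Suc z. f i j * of_bool (prod_encode (i, j) = z))
       = (\<Sum>i<Suc z. if i = nfst z then (\<Sum>j<Suc z. if j = nsnd z then f i j else 0) else 0)"
      by (intro sum.cong refl) auto
    also have "\<dots> = f (nfst z) (nsnd z)"
      using le by (simp add: sum.delta del: sum.lessThan_Suc)
    finally show ?thesis .
  qed
  have "recursive k (\<lambda>xs. \<Sum>i<Suc (a xs). \<Sum>j<Suc (a xs). i * of_bool (prod_encode (i, j) = a xs))"
    by (intro recursive_sum recursive_mult decidable_eq recursive_prod_encode recursive_Suc recursive_hd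
       recursive_tl a)
  then show "recursive k (\<lambda>xs. nfst (a xs))" by (simp only: *[of "\<lambda>i j. i"])
  have "recursive k (\<lambda>xs. \<Sum>i<Suc (a xs). \<Sum>j<Suc (a xs). j * of_bool (prod_encode (i, j) = a xs))"
    by (intro recursive_sum recursive_mult decidable_eq recursive_prod_encode recursive_Suc recursive_hd
       recursive_tl a)
  then show "recursive k (\<lambda>xs. nsnd (a xs))" by (simp only: *[of "\<lambda>i j. j"])
qed

text \<open>Partiality enters here: without a witness there is no value, and the equivalence records
  this as well. \<open>Minim\<close> looks for a zero, hence the indicator of the negation.\<close>

lemma recursive_minim:
  assumes "decidable (Suc k) (\<lambda>ys. P (hd ys) (tl ys))"
  obtains r where "\<And>xs y. length xs = k \<Longrightarrow>
     eval r xs y \<longleftrightarrow> (\<exists>w. P w xs) \<and> y = (LEAST w. P w xs)"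
proof -
  have "recursive (Suc k) (\<lambda>ys. of_bool (\<not> P (hd ys) (tl ys)))"
    using decidable_not[OF assms] .
  then obtain q where "\<forall>ys. length ys = Suc k \<longrightarrow> eval q ys (of_bool (\<not> P (hd ys) (tl ys)))"
    unfolding recursive_def by blast
  then have q: "eval q (w # xs) (of_bool (\<not> P w xs))" if "length xs = k" for w xs
    using that by (metis length_Cons list.sel)
  have "eval (Minim q) xs y \<longleftrightarrow> (\<exists>w. P w xs) \<and> y = (LEAST w. P w xs)" if "length xs = k" for xs y
  proof
    assume "eval (Minim q) xs y"
    then have y: "eval q (y # xs) 0" "\<forall>m<y. \<exists>v. v \<noteq> 0 \<and> eval q (m # xs) v"
      by (cases rule: eval.cases; auto)+
    have "P y xs" using eval_det[OF y(1) q[OF that]] by (auto split: if_splits)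
    moreover have "\<not> P m xs" if "m < y" for m
      using y(2) that eval_det[OF q[OF \<open>length xs = k\<close>]] by fastforce
    ultimately show "(\<exists>w. P w xs) \<and> y = (LEAST w. P w xs)"
      by (metis LeastI not_less_Least not_less_iff_gr_or_eq)
  next
    assume *: "(\<exists>w. P w xs) \<and> y = (LEAST w. P w xs)"
    then have "P y xs" by (metis LeastI)
    show "eval (Minim q) xs y"
    proof (rule eval_Minim)
      show "eval q (y # xs) 0" using q[OF that, of y] \<open>P y xs\<close> by simp
      show "\<forall>m<y. \<exists>v. v \<noteq> 0 \<and> eval q (m # xs) v"
      proof (intro allI impI)
        fix m assume "m < y"
        with * have "\<not> P m xs" using not_less_Least by blast
        with q[OF that, of m] show "\<exists>v. v \<noteq> 0 \<and> eval q (m # xs) v"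
          by (intro exI[of _ 1]) simp
      qed
    qed
  qed
  then show ?thesis using that by blast
qed

section \<open>Arithmetic coding of strings and simulation\<close>

text \<open>Adding 1 to the bijective base-2 code gives the number whose binary digits, least significant
  first, are those of the string followed by a leading 1; cutting out a factor of a string is then
  division and remainder by powers of two.\<close>

abbreviation num :: "bool list \<Rightarrow> nat" where "num u \<equiv> Suc (str_code u)"

abbreviation low :: "bool list \<Rightarrow> nat" where "low \<equiv> horner_sum of_bool 2"

lemma num_eq: "num u = low u + 2 ^ length u"
  by (induction u) auto

lemma low_less: "low u < 2 ^ length u"
proof (induction u)
  case (Cons b u)
  then show ?case by (cases b) auto
qed simp

lemma low_append: "low (u @ v) = low u + 2 ^ length u * low v"
  by (induction u) (auto simp: algebra_simps)

lemma num_append: "num (u @ v) = low u + 2 ^ length u * num v"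
  unfolding num_eq by (simp add: low_append power_add algebra_simps)

lemma num_ge: "2 ^ length u \<le> num u"
  by (simp only: num_eq le_add2)

lemma num_less: "num u < 2 ^ Suc (length u)"
  using low_less[of u] by (simp only: num_eq power_Suc)

lemma str_code_inj: "str_code u = str_code v \<Longrightarrow> u = v"
proof (induction u arbitrary: v)
  case Nil
  then show ?case by (cases v) (auto split: if_splits)
next
  case (Cons b u)
  then obtain b' v' where v: "v = b' # v'" by (cases v) (auto split: if_splits)
  have "2 * str_code u + (if b then 2 else 1) = 2 * str_code v' + (if b' then 2 else 1)"
    using Cons.prems v by simp
  then have "b = b'" "str_code u = str_code v'" by (cases b; cases b'; presburger)+
  with Cons.IH v show ?case by simp
qed

lemma str_code_surj: "\<exists>u. str_code u = n"
proof (induction n rule: less_induct)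
  case (less n)
  show ?case
  proof (cases "n = 0")
    case True
    then show ?thesis using str_code.simps(1) by blast
  next
    case False
    then have "(n - 1) div 2 < n" by simp
    then obtain u where u: "str_code u = (n - 1) div 2" using less by blast
    show ?thesis
    proof (intro exI)
      show "str_code (even n # u) = n" using u False by (simp, presburger)
    qed
  qed
qed

definition str_decode :: "nat \<Rightarrow> bool list" where
  "str_decode n = (THE u. str_code u = n)"

lemma str_code_decode [simp]: "str_code (str_decode n) = n"
  unfolding str_decode_def by (rule theI') (use str_code_surj str_code_inj in blast)

lemma str_decode_code [simp]: "str_decode (str_code u) = u"
  by (rule str_code_inj) simp

section \<open>Factors of strings on the level of codes\<close>

text \<open>For \<open>c = num ys\<close>, which lies between \<open>2 ^ length ys\<close> and its
  double, \<open>2 ^ (i + n) \<le> c\<close> says that the window of length \<open>n\<close> at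
  \<open>i\<close> stays inside \<open>ys\<close>. Adding \<open>2 ^ n\<close> restores the leading
  1 of the window. The bounds on \<open>i\<close> and \<open>n\<close> make the search
  finite.\<close>

definition occurs :: "nat \<Rightarrow> nat \<Rightarrow> bool" where
  "occurs a c \<longleftrightarrow> (\<exists>i<c. \<exists>n<c. 2 ^ (i + n) \<le> c \<and> (c div 2 ^ i) mod 2 ^ n + 2 ^ n = a)"

lemma num_slice:
  assumes "length u = n" "length w = i"
  shows "(num (w @ u @ v) div 2 ^ i) mod 2 ^ n + 2 ^ n = num u"
proof -
  have *: "(a + c * b) div c = b" "(a + c * b) mod c = a" if "a < c" for a b c :: nat
    using that by auto
  have "num (w @ u @ v) div 2 ^ i = num (u @ v)"
    unfolding num_append[of w] assms(2)[symmetric] using low_less by (rule *)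
  moreover have "num (u @ v) mod 2 ^ n = low u"
    unfolding num_append[of u] assms(1)[symmetric] using low_less by (rule *)
  ultimately show ?thesis
    by (simp only: num_eq[of u] assms(1))
qed

lemma occurs_num: "occurs (num u) (num ys) \<longleftrightarrow> sublist u ys"
proof
  assume "occurs (num u) (num ys)"
  then obtain i n where *: "2 ^ (i + n) \<le> num ys" "(num ys div 2 ^ i) mod 2 ^ n + 2 ^ n = num u"
    unfolding occurs_def by blast
  have "(2::nat) ^ (i + n) < 2 ^ Suc (length ys)" using *(1) num_less by (rule le_less_trans)
  then have "i + n < Suc (length ys)" by (rule power_less_imp_less_exp[rotated]) simp
  then have len: "length (take i ys) = i" "length (take n (drop i ys)) = n" by auto
  have ys: "take i ys @ take n (drop i ys) @ drop n (drop i ys) = ys"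
    by (simp only: append_take_drop_id)
  have "num u = num (take n (drop i ys))"
    using num_slice[OF len(2) len(1), of "drop n (drop i ys)"] *(2) unfolding ys by simp
  then have "u = take n (drop i ys)" using str_code_inj by blast
  then show "sublist u ys" unfolding sublist_def using ys by metis
next
  assume "sublist u ys"
  then obtain w v where ys: "ys = w @ u @ v" by (auto simp: sublist_def)
  let ?i = "length w" and ?n = "length u"
  have le: "2 ^ (?i + ?n) \<le> num ys"
    by (rule order_trans[OF _ num_ge]) (simp add: ys)
  moreover have "?i < num ys" "?n < num ys"
    using le less_exp[of "?i + ?n"] by linarith+
  ultimately show "occurs (num u) (num ys)"
    unfolding occurs_def using num_slice[of u ?n w ?i v] ys by blast
qed

section \<open>Simulation of the machine on natural numbers\<close>

definition bits :: "nat \<Rightarrow> nat \<Rightarrow> bool" where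
  "bits r i \<longleftrightarrow> odd (r div 2 ^ i)"

text \<open>A simulated configuration consists of the state, the unread random bits (as the number
  \<open>r div 2 ^ i\<close>), and the output \<open>out\<close> as \<open>2 ^ length out\<close> and \<open>num out\<close>.\<close>

definition cfg :: "nat \<Rightarrow> nat \<Rightarrow> nat \<Rightarrow> nat \<Rightarrow> nat" where
  "cfg s r l c = prod_encode (s, prod_encode (r, prod_encode (l, c)))"

definition sim_step :: "(nat \<Rightarrow> nat) \<Rightarrow> nat \<Rightarrow> nat" where
  "sim_step \<delta> x =
     (if \<delta> (nfst x) mod 4 = 0 then x
      else if \<delta> (nfst x) mod 4 = 1 then
        cfg (\<delta> (nfst x) div 4) (nfst (nsnd x)) (nfst (nsnd (nsnd x))) (nsnd (nsnd (nsnd x)))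
      else if \<delta> (nfst x) mod 4 = 2 then
        cfg (\<delta> (nfst x) div 4 div 2) (nfst (nsnd x)) (2 * nfst (nsnd (nsnd x)))
          (nsnd (nsnd (nsnd x)) + nfst (nsnd (nsnd x)) * (1 + \<delta> (nfst x) div 4 mod 2))
      else
        cfg (if odd (nfst (nsnd x)) then nsnd (\<delta> (nfst x) div 4) else nfst (\<delta> (nfst x) div 4))
          (nfst (nsnd x) div 2) (nfst (nsnd (nsnd x))) (nsnd (nsnd (nsnd x))))"

definition cfg_of :: "nat \<Rightarrow> nat \<times> nat \<times> bool list \<Rightarrow> nat" where
  "cfg_of r = (\<lambda>(s, i, out). cfg s (r div 2 ^ i) (2 ^ length out) (num out))"

text \<open>The leading 1 moves from place \<open>length u\<close> to the next one and leaves
  \<open>b\<close> behind, a change by \<open>2 ^ length u * (b + 2 - 1)\<close>.\<close>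

lemma num_snoc: "num (u @ [b]) = num u + 2 ^ length u * (1 + of_bool b)"
  unfolding num_append num_eq[of u] by (simp add: algebra_simps)

lemma sim_step: "sim_step \<delta> (cfg_of r x) = cfg_of r (pstep \<delta> (bits r) x)"
proof -
  obtain s i out where x: "x = (s, i, out)" by (cases x) auto
  have m: "v mod 4 = 0 \<or> v mod 4 = 1 \<or> v mod 4 = 2 \<or> v mod 4 = 3" for v :: nat by presburger
  have div2: "r div 2 ^ i div 2 = r div 2 ^ Suc i"
    by (simp add: div_mult2_eq[symmetric] mult.commute)
  show ?thesis
    using m[of "\<delta> s"]
    by (elim disjE)
       (simp_all add: x sim_step_def cfg_of_def cfg_def Let_def num_snoc bits_def div2 mod_2_eq_odd
         del: power_Suc str_code.simps, simp_all add: mult_2)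
qed

definition out_code :: "(nat \<Rightarrow> nat) \<Rightarrow> nat \<Rightarrow> nat \<Rightarrow> nat" where
  "out_code \<delta> r t = nsnd (nsnd (nsnd ((sim_step \<delta> ^^ t) (cfg 0 r 1 1))))"

lemma out_code: "out_code \<delta> r t = num (poutput \<delta> (bits r) t)"
proof -
  have "(sim_step \<delta> ^^ t) (cfg 0 r 1 1) = cfg_of r (pconfig \<delta> (bits r) t)"
  proof (induction t)
    case 0
    show ?case by (simp add: pconfig_def cfg_of_def)
  next
    case (Suc t)
    then show ?case by (simp add: pconfig_def sim_step)
  qed
  then show ?thesis
    by (simp add: out_code_def poutput_def cfg_of_def cfg_def split: prod.split)
qed

section \<open>Exhaustive search for a hitting list\<close>

text \<open>Every number codes an infinite sequence in this way, so no search candidate is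
  ill-formed; the length of a list must be stored as an entry of its own.\<close>

definition entry :: "nat \<Rightarrow> nat \<Rightarrow> nat" where
  "entry w j = nfst ((nsnd ^^ j) w)"

lemma entry_list: "\<exists>w. \<forall>j<length xs. entry w j = xs ! j"
proof (induction xs)
  case (Cons x xs)
  then obtain w where w: "\<forall>j<length xs. entry w j = xs ! j" by blast
  have "entry (prod_encode (x, w)) j = (x # xs) ! j" if "j < length (x # xs)" for j
    using that w by (cases j) (auto simp: entry_def funpow_Suc_right simp del: funpow.simps(2))
  then show ?case by blast
qed simp

text \<open>The constraint on \<open>F ! j\<close> makes it long compared with the description \<open>(m, j)\<close>, whose length
  is about \<open>2 log (m + j)\<close>. The rational \<open>a / q\<close> is a lower bound for the probability that the
  output up to time \<open>t\<close> has a factor in \<open>F\<close>.\<close>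

definition hits :: "(nat \<Rightarrow> nat) \<Rightarrow> nat \<Rightarrow> nat \<Rightarrow> nat \<Rightarrow> nat \<Rightarrow> nat \<Rightarrow> bool list list \<Rightarrow> bool" where
  "hits \<delta> K a q m t F \<longleftrightarrow> (\<forall>j<length F. (m + j + 1) ^ K \<le> num (F ! j)) \<and>
     a * 2 ^ t \<le> q * card {r. r < 2 ^ t \<and> (\<exists>f\<in>set F. sublist f (poutput \<delta> (bits r) t))}"

text \<open>Layout of a candidate \<open>w\<close>: the time at entry 0, the number of strings at
  entry 1, their codes from entry 2 on. Every quantifier and sum is bounded, so a candidate can be
  tested.\<close>

definition hits_code :: "(nat \<Rightarrow> nat) \<Rightarrow> nat \<Rightarrow> nat \<Rightarrow> nat \<Rightarrow> nat \<Rightarrow> nat \<Rightarrow> bool" where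
  "hits_code \<delta> K a q m w \<longleftrightarrow>
     (\<forall>j<entry w 1. (m + j + 1) ^ K \<le> Suc (entry w (j + 2))) \<and>
     a * 2 ^ entry w 0 \<le> q * (\<Sum>r<2 ^ entry w 0.
        of_bool (\<exists>j<entry w 1. occurs (Suc (entry w (j + 2))) (out_code \<delta> r (entry w 0))))"

lemma hits_code_iff:
  assumes "length F = entry w 1" "\<And>j. j < entry w 1 \<Longrightarrow> entry w (j + 2) = str_code (F ! j)"
  shows "hits_code \<delta> K a q m w \<longleftrightarrow> hits \<delta> K a q m (entry w 0) F"
proof -
  have "occurs (Suc (entry w (j + 2))) (out_code \<delta> r (entry w 0)) \<longleftrightarrow>
      sublist (F ! j) (poutput \<delta> (bits r) (entry w 0))" if "j < entry w 1" for r j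
    by (simp only: assms(2)[OF that] out_code occurs_num)
  then have "(\<exists>j<entry w 1. occurs (Suc (entry w (j + 2))) (out_code \<delta> r (entry w 0))) \<longleftrightarrow>
      (\<exists>j<entry w 1. sublist (F ! j) (poutput \<delta> (bits r) (entry w 0)))" for r
    by blast
  also have "(\<exists>j<entry w 1. sublist (F ! j) (poutput \<delta> (bits r) (entry w 0))) \<longleftrightarrow>
      (\<exists>f\<in>set F. sublist f (poutput \<delta> (bits r) (entry w 0)))" for r
    unfolding assms(1)[symmetric] set_conv_nth by blast
  finally have hit: "(\<exists>j<entry w 1. occurs (Suc (entry w (j + 2))) (out_code \<delta> r (entry w 0))) \<longleftrightarrow>
      (\<exists>f\<in>set F. sublist f (poutput \<delta> (bits r) (entry w 0)))" for r .
  have "(\<Sum>r<n. of_bool (Q r)) = card {r. r < n \<and> Q r}" for n :: nat and Q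
    by (simp add: Int_def)
  moreover have "(\<forall>j<entry w 1. (m + j + 1) ^ K \<le> Suc (entry w (j + 2))) \<longleftrightarrow>
      (\<forall>j<length F. (m + j + 1) ^ K \<le> num (F ! j))"
    unfolding assms(1) using assms(2) by (auto simp del: One_nat_def add_2_eq_Suc')
  ultimately show ?thesis
    unfolding hits_code_def hits_def hit by (simp only:)
qed

lemma recursive_sim_step:
  assumes "computable \<delta>" "recursive k a"
  shows "recursive k (\<lambda>xs. sim_step \<delta> (a xs))"
  unfolding sim_step_def cfg_def
  by (intro recursive_if decidable_eq recursive_mod recursive_computable[OF assms(1)]
      recursive_prod_decode recursive_prod_encode recursive_div recursive_mult recursive_add
      decidable_odd recursive_const assms(2))

lemma recursive_out_code:
  assumes "computable \<delta>" "recursive k a" "recursive k b"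
  shows "recursive k (\<lambda>xs. out_code \<delta> (a xs) (b xs))"
  unfolding out_code_def cfg_def
  by (intro recursive_funpow recursive_prod_decode recursive_prod_encode recursive_const
      recursive_sim_step[OF assms(1)] recursive_hd assms)

lemma recursive_entry:
  assumes "recursive k a" "recursive k b"
  shows "recursive k (\<lambda>xs. entry (a xs) (b xs))"
  unfolding entry_def
  by (intro recursive_funpow recursive_prod_decode recursive_hd assms)

lemma decidable_occurs:
  assumes "recursive k a" "recursive k b"
  shows "decidable k (\<lambda>xs. occurs (a xs) (b xs))"
  unfolding occurs_def
  by (intro decidable_bex decidable_conj decidable_le decidable_eq recursive_add recursive_mod
      recursive_div recursive_power recursive_hd recursive_const recursive_tl assms)

lemma decidable_hits_code:
  assumes "computable \<delta>" "recursive k b" "recursive k c"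
  shows "decidable k (\<lambda>xs. hits_code \<delta> K a q (b xs) (c xs))"
  unfolding hits_code_def
  by (intro decidable_conj decidable_ball decidable_bex decidable_le recursive_entry recursive_power
      recursive_add recursive_mult recursive_sum recursive_Suc decidable_occurs
      recursive_out_code[OF assms(1)] recursive_hd recursive_const recursive_tl assms)

text \<open>A program is read as the code of a pair \<open>(m, j)\<close> and asks for the
  \<open>j\<close>-th member of the first list that the search for \<open>m\<close> finds;
  \<open>K\<close>, \<open>a\<close> and \<open>q\<close> are built into the decompressor.\<close>

lemma hitting_decompressor:
  assumes "computable \<delta>"
  shows "\<exists>E. decompressor E \<and> (\<forall>m t F. hits \<delta> K a q m t F \<longrightarrow>
     (\<exists>t F. hits \<delta> K a q m t F \<and>
        (\<forall>j<length F. \<exists>p. 2 ^ length p \<le> (m + j + 1) ^ 2 \<and> E p = Some (F ! j))))"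
proof -
  \<comment> \<open>All \<open>j\<close> must refer to the same list, so the least code \<open>W m\<close> depends on \<open>m\<close> only.\<close>
  define P where "P w xs \<longleftrightarrow> hits_code \<delta> K a q (nfst (xs ! 0)) w" for w and xs :: "nat list"
  define W where "W m = (LEAST w. hits_code \<delta> K a q m w)" for m
  have "decidable (Suc 1) (\<lambda>ys. P (hd ys) (tl ys))"
    unfolding P_def
    by (intro decidable_hits_code[OF assms] recursive_prod_decode recursive_tl recursive_nth recursive_hd)
       simp
  then obtain r where r: "\<And>xs y. length xs = 1 \<Longrightarrow>
     eval r xs y \<longleftrightarrow> (\<exists>w. P w xs) \<and> y = (LEAST w. P w xs)" by (rule recursive_minim) blast
  have "recursive 2 (\<lambda>ys. entry (ys ! 0) (nsnd (ys ! 1) + 2))"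
    by (intro recursive_entry recursive_add recursive_prod_decode recursive_nth recursive_const) auto
  then obtain h where "\<forall>ys. length ys = 2 \<longrightarrow> eval h ys (entry (ys ! 0) (nsnd (ys ! 1) + 2))"
    unfolding recursive_def by blast
  from this[THEN spec, of "[x, y]" for x y]
  have h: "eval h [x, y] (entry x (nsnd y + 2))" for x y by simp
  \<comment> \<open>Undefined exactly if the search for \<open>m\<close> fails. For \<open>j\<close>
    beyond the end of the list the value is some string about which nothing is claimed.\<close>
  define E where "E p = (if \<exists>w. hits_code \<delta> K a q (nfst (str_code p)) w
      then Some (str_decode (entry (W (nfst (str_code p))) (nsnd (str_code p) + 2))) else None)" for p
  have E_Some: "E p = Some u \<longleftrightarrow> (\<exists>w. hits_code \<delta> K a q (nfst (str_code p)) w) \<and>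
      str_code u = entry (W (nfst (str_code p))) (nsnd (str_code p) + 2)" for p u
  proof -
    have "str_decode n = u \<longleftrightarrow> str_code u = n" for n by auto
    then show ?thesis unfolding E_def by simp
  qed
  have "eval (Comp h [r, Proj 0]) [x] y \<longleftrightarrow> (\<exists>w. hits_code \<delta> K a q (nfst x) w) \<and>
      y = entry (W (nfst x)) (nsnd x + 2)" (is "?L \<longleftrightarrow> ?R") for x y
  proof
    assume ?L
    then obtain ys where ys: "list_all2 (\<lambda>g y. eval g [x] y) [r, Proj 0] ys" "eval h ys y"
      by (cases rule: eval.cases) auto
    then obtain y1 y2 where ys_eq: "ys = [y1, y2]" and y1: "eval r [x] y1" and y2: "eval (Proj 0) [x] y2"
      by (auto simp: list_all2_Cons1)
    from y2 have "y2 = x" by (cases rule: eval.cases) auto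
    moreover have "(\<exists>w. hits_code \<delta> K a q (nfst x) w) \<and> y1 = W (nfst x)"
      using y1 r[of "[x]"] by (simp add: P_def W_def)
    ultimately show ?R using ys(2) eval_det[OF h] by (auto simp: ys_eq)
  next
    assume R: ?R
    have "eval r [x] (W (nfst x))" using R r[of "[x]"] by (simp add: P_def W_def)
    moreover have "eval (Proj 0) [x] x" using eval_Proj[of 0 "[x]"] by simp
    ultimately show ?L using R h by (auto intro: eval_Comp[of _ _ "[W (nfst x), x]"])
  qed
  then have "decompressor E"
    unfolding decompressor_def E_Some by blast
  moreover have "\<exists>t F. hits \<delta> K a q m t F \<and>
        (\<forall>j<length F. \<exists>p. 2 ^ length p \<le> (m + j + 1) ^ 2 \<and> E p = Some (F ! j))"
    if "hits \<delta> K a q m t F" for m t F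
  proof -
    obtain w where "\<forall>j<length (t # length F # map str_code F). entry w j = (t # length F # map str_code F) ! j"
      using entry_list by blast
    then have w: "entry w 0 = t" "entry w 1 = length F" "\<And>j. j < length F \<Longrightarrow> entry w (j + 2) = str_code (F ! j)"
      by (auto simp: nth_Cons split: nat.splits)
    have ex: "hits_code \<delta> K a q m w"
      using that w hits_code_iff[of F w] by simp
    then have hW: "hits_code \<delta> K a q m (W m)" unfolding W_def by (rule LeastI)
    \<comment> \<open>The least code need not come from \<open>F\<close>, so the conclusion concerns
      the list \<open>G\<close> read off from it; this is always possible because every number is
      the code of a string.\<close>
    define G where "G = map (\<lambda>j. str_decode (entry (W m) (j + 2))) [0..<entry (W m) 1]"
    have G: "length G = entry (W m) 1" "\<And>j. j < entry (W m) 1 \<Longrightarrow> entry (W m) (j + 2) = str_code (G ! j)"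
      by (auto simp: G_def)
    have "hits \<delta> K a q m (entry (W m) 0) G" using hW hits_code_iff[OF G] by blast
    moreover have "\<exists>p. 2 ^ length p \<le> (m + j + 1) ^ 2 \<and> E p = Some (G ! j)" if "j < length G" for j
    proof (intro exI conjI)
      let ?p = "str_decode (prod_encode (m, j))"
      \<comment> \<open>The pairing function is quadratic, whence the exponent 2. The added 1 turns
        the code of the program into its \<open>num\<close>, which is at least
        \<open>2 ^ length ?p\<close>.\<close>
      have "prod_encode (m, j) + 1 \<le> (m + j + 1) ^ 2"
        by (simp add: prod_encode_def triangle_def power2_eq_square)
      then show "2 ^ length ?p \<le> (m + j + 1) ^ 2"
        using num_ge[of ?p] by simp
      show "E ?p = Some (G ! j)"
        using ex that G by (auto simp: E_Some)
    qed
    ultimately show ?thesis by blast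
  qed
  ultimately show ?thesis by blast
qed

section \<open>Sparse lists of strings hitting long sequences\<close>

text \<open>Each remaining \<open>D x\<close> contains at least \<open>d\<close> of at most
  \<open>v\<close> elements, so by averaging some element lies in a fraction \<open>d / v\<close> of
  the remaining sets; choosing it multiplies the number left over by at most
  \<open>1 - d / v\<close>.\<close>

lemma greedy_cover:
  fixes D :: "'x \<Rightarrow> 'a set" and v d b :: nat
  assumes "finite X" "finite V" "card V \<le> v" "0 < v"
    and D: "\<And>x. x \<in> X \<Longrightarrow> D x \<subseteq> V \<and> d \<le> card (D x)"
  shows "\<exists>F. set F \<subseteq> V \<and> length F \<le> b \<and>
     real (card {x \<in> X. D x \<inter> set F = {}}) \<le> (1 - d / v) ^ b * card X"
proof (induction b)
  case 0
  show ?case by (rule exI[of _ "[]"]) simp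
next
  case (Suc b)
  then obtain F where F: "set F \<subseteq> V" "length F \<le> b"
    "real (card {x \<in> X. D x \<inter> set F = {}}) \<le> (1 - d / v) ^ b * card X" by blast
  define Y where "Y = {x \<in> X. D x \<inter> set F = {}}"
  define cnt where "cnt f = card {x \<in> Y. f \<in> D x}" for f
  have finY: "finite Y" and YX: "Y \<subseteq> X" using assms(1) by (auto simp: Y_def)
  show ?case
  proof (cases "Y = {}")
    case True
    \<comment> \<open>The bound \<open>d \<le> v\<close> comes from a member of \<open>X\<close>;
      for empty \<open>X\<close> the product vanishes.\<close>
    have "0 \<le> (1 - real d / v) ^ Suc b * card X"
    proof (cases "X = {}")
      case False
      then obtain x where "x \<in> X" by blast
      with D[OF this] assms have "d \<le> v" by (meson card_mono le_trans)
      with \<open>0 < v\<close> show ?thesis by simp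
    qed simp
    moreover from True have "{x \<in> X. D x \<inter> set F = {}} = {}" by (simp only: Y_def)
    ultimately show ?thesis using F(1,2)
      by (intro exI[of _ F]) (simp only: card.empty, simp)
  next
    case False
    then obtain x where x: "x \<in> X" using YX by blast
    have dv: "d \<le> v" using D[OF x] assms by (meson card_mono le_trans)
    have double: "(\<Sum>f\<in>V. cnt f) = (\<Sum>x\<in>Y. card (D x))"
    proof -
      have "(\<Sum>f\<in>V. cnt f) = (\<Sum>f\<in>V. \<Sum>x\<in>Y. if f \<in> D x then 1 else 0)"
        using finY by (simp add: cnt_def sum.If_cases Int_def)
      also have "\<dots> = (\<Sum>x\<in>Y. \<Sum>f\<in>V. if f \<in> D x then 1 else 0)"
        by (rule sum.swap)
      also have "\<dots> = (\<Sum>x\<in>Y. card (V \<inter> D x))"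
        using \<open>finite V\<close> by (simp add: sum.If_cases)
      also have "\<dots> = (\<Sum>x\<in>Y. card (D x))"
        using D YX by (intro sum.cong arg_cong[of _ _ card]) auto
      finally show ?thesis .
    qed
    have "\<exists>F'. set F' \<subseteq> V \<and> length F' \<le> Suc b \<and>
         real (card {x \<in> X. D x \<inter> set F' = {}}) \<le> (1 - d / v) * card Y"
    proof (cases "V = {}")
      case True
      with D[OF x] have "d = 0" by auto
      with F show ?thesis by (intro exI[of _ F]) (simp add: Y_def)
    next
      case False
      \<comment> \<open>If every \<open>f\<close> in \<open>V\<close> occurred in less than a
        fraction \<open>d / v\<close> of the sets, the double count would fall below
        \<open>d * card Y\<close>.\<close>
      have "\<exists>f\<in>V. d * card Y \<le> v * cnt f"
      proof (rule ccontr)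
        assume "\<not> ?thesis"
        then have "(\<Sum>f\<in>V. v * cnt f) < (\<Sum>f\<in>V. d * card Y)"
          using False \<open>finite V\<close> by (intro sum_strict_mono) (auto simp: not_le)
        also have "\<dots> \<le> v * (d * card Y)"
          using assms(3) by (simp del: mult.assoc)
        also have "\<dots> \<le> v * (\<Sum>f\<in>V. cnt f)"
        proof -
          have "(\<Sum>x\<in>Y. d) \<le> (\<Sum>x\<in>Y. card (D x))"
            using D YX by (intro sum_mono) auto
          then show ?thesis unfolding double by (simp add: mult.commute)
        qed
        finally show False by (simp add: sum_distrib_left)
      qed
      then obtain f where f: "f \<in> V" "d * card Y \<le> v * cnt f" by blast
      have "{x \<in> X. D x \<inter> set (f # F) = {}} = Y - {x \<in> Y. f \<in> D x}"
        by (auto simp: Y_def)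
      then have "card {x \<in> X. D x \<inter> set (f # F) = {}} = card Y - cnt f"
        using finY by (simp add: cnt_def card_Diff_subset)
      moreover have "cnt f \<le> card Y" using finY by (auto simp: cnt_def intro: card_mono)
      moreover have "real d / v * card Y \<le> cnt f"
        using f(2) \<open>0 < v\<close> by (simp add: field_simps flip: of_nat_mult)
      ultimately have "real (card {x \<in> X. D x \<inter> set (f # F) = {}}) \<le> (1 - d / v) * card Y"
        by (simp add: of_nat_diff algebra_simps)
      with F f show ?thesis by (intro exI[of _ "f # F"]) auto
    qed
    moreover have "(1 - real d / v) * card Y \<le> (1 - d / v) ^ Suc b * card X"
    proof -
      have "(1 - real d / v) * card Y \<le> (1 - d / v) * ((1 - d / v) ^ b * card X)"
        using F(3) dv \<open>0 < v\<close> unfolding Y_def[symmetric] by (intro mult_left_mono) auto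
      then show ?thesis by simp
    qed
    ultimately show ?thesis by (meson order_trans)
  qed
qed

definition meets :: "nat \<Rightarrow> bool list list \<Rightarrow> (nat \<Rightarrow> bool) \<Rightarrow> bool" where
  "meets N F y \<longleftrightarrow> (\<exists>f\<in>set F. \<exists>k. k + length f \<le> N \<and> substr y k (length f) = f)"

text \<open>The offset \<open>J\<close> makes the condition composable: behind at most
  \<open>b\<close> strings a list with offset \<open>J + b\<close> may be appended, since positions
  are shifted by no more than \<open>b\<close>.\<close>

definition sparse_list :: "nat \<Rightarrow> nat \<Rightarrow> bool list list \<Rightarrow> bool" where
  "sparse_list K J F \<longleftrightarrow> (\<forall>j<length F. (J + j + 1) ^ K \<le> 2 ^ length (F ! j))"

text \<open>Sequences cut into aligned blocks of length \<open>n\<close> are regarded as words over an alphabet \<open>V\<close> of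
  at most \<open>v\<close> blocks; \<open>X\<close> with \<open>s\<close> is a finite multiset of sequences, that is, an arbitrary
  rational distribution on them.\<close>

definition hittable :: "nat \<Rightarrow> nat \<Rightarrow> real \<Rightarrow> nat \<Rightarrow> nat \<Rightarrow> bool" where
  "hittable K J \<epsilon> n v \<longleftrightarrow> (\<exists>N. \<forall>V X (s :: nat \<Rightarrow> nat \<Rightarrow> bool).
     V \<subseteq> {u. length u = n} \<and> card V \<le> v \<and> finite X \<and>
     (\<forall>x\<in>X. \<forall>q. (q + 1) * n \<le> N \<longrightarrow> substr (s x) (q * n) n \<in> V) \<longrightarrow>
     (\<exists>F. sparse_list K J F \<and> real (card {x \<in> X. \<not> meets N F (s x)}) \<le> \<epsilon> * card X))"

lemma hittable_mono: "hittable K J \<epsilon> n v \<Longrightarrow> v' \<le> v \<Longrightarrow> hittable K J \<epsilon> n v'"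
  unfolding hittable_def by (elim exE, rule exI) (blast intro: le_trans)

lemma length_substr [simp]: "length (substr y k n) = n"
  by (simp add: substr_def)

lemma finite_strings: "finite {u :: bool list. length u = n}"
  using finite_lists_length_eq[of "UNIV :: bool set" n] by simp

lemma card_strings: "card {u :: bool list. length u = n} = 2 ^ n"
  using card_lists_length_eq[of "UNIV :: bool set" n] by simp

text \<open>The alphabet itself is short enough to be listed, and the first block of every
  admissible sequence belongs to it; so \<open>N = n\<close> suffices and nothing is missed.\<close>

lemma hittable_small_alphabet:
  assumes "(J + v) ^ K \<le> 2 ^ n" "0 \<le> \<epsilon>"
  shows "hittable K J \<epsilon> n v"
  unfolding hittable_def
proof (intro exI[of _ n] allI impI, elim conjE)
  fix V X and s :: "nat \<Rightarrow> nat \<Rightarrow> bool"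
  assume V: "V \<subseteq> {u. length u = n}" "card V \<le> v"
    and s: "\<forall>x\<in>X. \<forall>q. (q + 1) * n \<le> n \<longrightarrow> substr (s x) (q * n) n \<in> V"
  obtain F where F: "set F = V" "distinct F"
    using V(1) finite_subset[OF _ finite_strings] finite_distinct_list by metis
  have "sparse_list K J F"
    unfolding sparse_list_def
  proof (intro allI impI)
    fix j assume j: "j < length F"
    then have "(J + j + 1) ^ K \<le> (J + v) ^ K"
      using V(2) F distinct_card[OF F(2)] by (intro power_mono) auto
    also have "length (F ! j) = n" using j F V(1) nth_mem by blast
    ultimately show "(J + j + 1) ^ K \<le> 2 ^ length (F ! j)" using assms(1) by simp
  qed
  moreover have "meets n F (s x)" if "x \<in> X" for x
  proof -
    have "substr (s x) 0 n \<in> V" using s that by force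
    then show ?thesis unfolding meets_def F(1)
      by (intro bexI[of _ "substr (s x) 0 n"] exI[of _ 0]) auto
  qed
  then have "{x \<in> X. \<not> meets n F (s x)} = {}" by blast
  ultimately show "\<exists>F. sparse_list K J F \<and> real (card {x \<in> X. \<not> meets n F (s x)}) \<le> \<epsilon> * card X"
    using \<open>0 \<le> \<epsilon>\<close> by (intro exI[of _ F]) (simp only: card.empty, simp)
qed

lemma substr_mult: "substr y p (n * k) = concat (map (\<lambda>j. substr y (p + j * n) n) [0..<k])"
proof (induction k)
  case (Suc k)
  have "[p..<p + n * Suc k] = [p..<p + n * k] @ [p + n * k..<p + n * k + n]"
    using upt_add_eq_append[of p "p + n * k" n] by (simp add: ac_simps)
  then have "substr y p (n * Suc k) = substr y p (n * k) @ substr y (p + k * n) n"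
    unfolding substr_def by (simp only: map_append mult.commute)
  with Suc show ?case by simp
qed (simp add: substr_def)

text \<open>A sequence with at least \<open>d\<close> distinct blocks is likely to be hit by \<open>b\<close> greedily chosen blocks.
  Any other sequence, cut into groups of \<open>k\<close> blocks, is a word over an alphabet of size at most
  \<open>v ^ d * d ^ k\<close>: choose \<open>d\<close> blocks, then \<open>k\<close> indices into them.\<close>

lemma hittable_regroup:
  assumes "0 < v" "1 \<le> k" and b: "(J + b) ^ K \<le> 2 ^ n" and \<epsilon>1: "(1 - real d / v) ^ b \<le> \<epsilon>1"
    and next_level: "hittable K (J + b) \<epsilon>2 (n * k) (v ^ d * d ^ k)"
    and "0 \<le> \<epsilon>1" "0 \<le> \<epsilon>2"
  shows "hittable K J (\<epsilon>1 + \<epsilon>2) n v"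
proof -
  from next_level[unfolded hittable_def] obtain N where N: "\<forall>V X (s :: nat \<Rightarrow> nat \<Rightarrow> bool).
     V \<subseteq> {u. length u = n * k} \<and> card V \<le> v ^ d * d ^ k \<and> finite X \<and>
     (\<forall>x\<in>X. \<forall>q. (q + 1) * (n * k) \<le> N \<longrightarrow> substr (s x) (q * (n * k)) (n * k) \<in> V) \<longrightarrow>
     (\<exists>F. sparse_list K (J + b) F \<and> real (card {x \<in> X. \<not> meets N F (s x)}) \<le> \<epsilon>2 * card X)" ..
  show ?thesis
    unfolding hittable_def
  \<comment> \<open>One prefix length serves both levels: the distinct blocks are counted within the
    \<open>N\<close> supplied by the next level.\<close>
  proof (intro exI[of _ N] allI impI, elim conjE)
    fix V X and s :: "nat \<Rightarrow> nat \<Rightarrow> bool"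
    assume V: "V \<subseteq> {u. length u = n}" "card V \<le> v" and X: "finite X"
      and s: "\<forall>x\<in>X. \<forall>q. (q + 1) * n \<le> N \<longrightarrow> substr (s x) (q * n) n \<in> V"
    have finV: "finite V" using V(1) finite_strings finite_subset by blast
    define D where "D x = {substr (s x) (q * n) n |q. (q + 1) * n \<le> N}" for x
    have DV: "D x \<subseteq> V" if "x \<in> X" for x using s that by (auto simp: D_def)
    define X1 X2 where "X1 = {x \<in> X. d \<le> card (D x)}" and "X2 = {x \<in> X. card (D x) < d}"
    have X12: "finite X1" "finite X2" "X = X1 \<union> X2" "X1 \<inter> X2 = {}"
      using X by (auto simp: X1_def X2_def)
    have "D x \<subseteq> V \<and> d \<le> card (D x)" if "x \<in> X1" for x
      using that DV by (simp add: X1_def)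
    from greedy_cover[where D = D and b = b, OF X12(1) finV V(2) assms(1) this]
    obtain F1 where F1: "set F1 \<subseteq> V" "length F1 \<le> b"
      "real (card {x \<in> X1. D x \<inter> set F1 = {}}) \<le> (1 - d / v) ^ b * card X1"
      by blast
    define word where "word = (\<lambda>(ds :: bool list list, is). concat (map ((!) ds) is))"
    define P where "P = {ds. set ds \<subseteq> V \<and> length ds = d} \<times> {is. set is \<subseteq> {..<d} \<and> length is = k}"
    have finP: "finite P"
      using finV by (auto simp: P_def intro: finite_lists_length_eq)
    have "card (word ` P) \<le> card V ^ d * d ^ k"
      using card_image_le[OF finP, of word] finV
      by (simp add: P_def card_cartesian_product card_lists_length_eq)
    also have "\<dots> \<le> v ^ d * d ^ k" using V(2) by (intro mult_right_mono power_mono) auto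
    finally have cardW: "card (word ` P) \<le> v ^ d * d ^ k" .
    have lenW: "word ` P \<subseteq> {u. length u = n * k}"
    proof
      fix u assume "u \<in> word ` P"
      then obtain ds "is" where u: "u = concat (map ((!) ds) is)" "set ds \<subseteq> V" "length ds = d"
        "set is \<subseteq> {..<d}" "length is = k" by (auto simp: P_def word_def)
      have "length (ds ! i) = n" if "i \<in> set is" for i
      proof -
        have "ds ! i \<in> set ds" using that u(3,4) by auto
        then show ?thesis using u(2) V(1) by auto
      qed
      then have "map (length \<circ> (!) ds) is = map (\<lambda>_. n) is" by simp
      then show "u \<in> {u. length u = n * k}"
        using u(5) by (simp add: u(1) length_concat o_def sum_list_triv del: map_eq_conv)
    qed
    have blocks: "substr (s x) (q * (n * k)) (n * k) \<in> word ` P"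
      if x: "x \<in> X2" and q: "(q + 1) * (n * k) \<le> N" for x q
    proof -
      have xX: "x \<in> X" and card_D: "card (D x) < d" using x by (auto simp: X2_def)
      define f where "f j = substr (s x) (q * (n * k) + j * n) n" for j
      have f: "f j \<in> D x" if "j < k" for j
      proof -
        have "(j + 1) * n \<le> k * n" using that by (intro mult_right_mono) auto
        then have "(q * k + j + 1) * n \<le> N" using q by (simp add: algebra_simps)
        then show ?thesis unfolding D_def f_def
          by (intro CollectI exI[of _ "q * k + j"]) (simp add: algebra_simps)
      qed
      obtain ds0 where ds0: "set ds0 = D x" "distinct ds0"
        using finite_distinct_list[OF finite_subset[OF DV[OF xX] finV]] by blast
      have len0: "length ds0 < d" using ds0 card_D distinct_card by fastforce
      have ne: "ds0 \<noteq> []" using f[of 0] \<open>1 \<le> k\<close> ds0 by auto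
      \<comment> \<open>Padding by a repeated block gives exactly \<open>d\<close> entries, as
        \<open>P\<close> requires; \<open>1 \<le> k\<close> guarantees that there is a block to
        repeat.\<close>
      define ds where "ds = ds0 @ replicate (d - length ds0) (hd ds0)"
      have ds: "set ds = D x" "length ds = d"
        using len0 ne ds0 hd_in_set[OF ne] by (auto simp: ds_def)
      have "\<forall>j. \<exists>i. j < k \<longrightarrow> i < d \<and> ds ! i = f j"
        using f ds by (metis in_set_conv_nth)
      then obtain idx where idx: "\<And>j. j < k \<Longrightarrow> idx j < d \<and> ds ! idx j = f j" by metis
      have "substr (s x) (q * (n * k)) (n * k) = concat (map f [0..<k])"
        unfolding f_def by (rule substr_mult)
      also have "\<dots> = word (ds, map idx [0..<k])"
        using idx by (auto simp: word_def intro!: arg_cong[of _ _ concat])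
      finally show ?thesis
        using ds idx DV[OF xX] by (auto simp: P_def intro!: image_eqI)
    qed
    obtain F2 where F2: "sparse_list K (J + b) F2"
      "real (card {x \<in> X2. \<not> meets N F2 (s x)}) \<le> \<epsilon>2 * card X2"
      using N[THEN spec, THEN spec, THEN spec, THEN mp, OF conjI[OF lenW conjI[OF cardW conjI[OF X12(2)]]]]
        blocks by blast
    have "sparse_list K J (F1 @ F2)"
      unfolding sparse_list_def
    proof (intro allI impI)
      fix j assume j: "j < length (F1 @ F2)"
      show "(J + j + 1) ^ K \<le> 2 ^ length ((F1 @ F2) ! j)"
      proof (cases "j < length F1")
        case True
        then have "(J + j + 1) ^ K \<le> (J + b) ^ K" using F1(2) by (intro power_mono) auto
        moreover have "length (F1 ! j) = n" using True F1(1) V(1) nth_mem by blast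
        ultimately show ?thesis using b True by (simp add: nth_append)
      next
        case False
        then have "(J + j + 1) ^ K \<le> ((J + b) + (j - length F1) + 1) ^ K"
          using F1(2) by (intro power_mono) auto
        also have "\<dots> \<le> 2 ^ length (F2 ! (j - length F1))"
          using F2(1)[unfolded sparse_list_def, rule_format, of "j - length F1"] j False by simp
        finally show ?thesis using False by (simp add: nth_append)
      qed
    qed
    moreover have "real (card {x \<in> X. \<not> meets N (F1 @ F2) (s x)}) \<le> (\<epsilon>1 + \<epsilon>2) * card X"
    proof -
      have "{x \<in> X. \<not> meets N (F1 @ F2) (s x)} \<subseteq>
          {x \<in> X1. D x \<inter> set F1 = {}} \<union> {x \<in> X2. \<not> meets N F2 (s x)}"
      proof
        fix x assume x: "x \<in> {x \<in> X. \<not> meets N (F1 @ F2) (s x)}"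
        show "x \<in> {x \<in> X1. D x \<inter> set F1 = {}} \<union> {x \<in> X2. \<not> meets N F2 (s x)}"
        proof (cases "x \<in> X1")
          case True
          have "D x \<inter> set F1 = {}"
          proof (rule ccontr)
            assume "D x \<inter> set F1 \<noteq> {}"
            then obtain q where "substr (s x) (q * n) n \<in> set F1" "(q + 1) * n \<le> N"
              by (auto simp: D_def)
            then have "meets N (F1 @ F2) (s x)"
              unfolding meets_def
              by (intro bexI[of _ "substr (s x) (q * n) n"] exI[of _ "q * n"]) (auto simp: algebra_simps)
            with x show False by blast
          qed
          with True show ?thesis by blast
        next
          case False
          with x X12 show ?thesis by (auto simp: meets_def)
        qed
      qed
      then have "card {x \<in> X. \<not> meets N (F1 @ F2) (s x)} \<le>
          card {x \<in> X1. D x \<inter> set F1 = {}} + card {x \<in> X2. \<not> meets N F2 (s x)}"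
        by (rule order_trans[OF card_mono card_Un_le, rotated]) (simp add: X12)
      moreover have "(1 - d / v) ^ b * card X1 \<le> \<epsilon>1 * card X"
        using \<epsilon>1 X12 X \<open>0 \<le> \<epsilon>1\<close> by (intro mult_mono) (auto intro: card_mono)
      moreover have "\<epsilon>2 * card X2 \<le> \<epsilon>2 * card X"
        using X12 X \<open>0 \<le> \<epsilon>2\<close> by (intro mult_left_mono) (auto intro: card_mono)
      ultimately show ?thesis using F1(3) F2(2) by (simp add: algebra_simps)
    qed
    ultimately show "\<exists>F. sparse_list K J F \<and> real (card {x \<in> X. \<not> meets N F (s x)}) \<le> (\<epsilon>1 + \<epsilon>2) * card X"
      by blast
  qed
qed

text \<open>Multiply by \<open>(1 + x) ^ b\<close>: the product is at most 1 because
  \<open>(1 - x) * (1 + x) \<le> 1\<close>, while \<open>(1 + x) ^ b\<close> is at least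
  \<open>b * x\<close> by Bernoulli. This polynomial bound is enough, as \<open>b * x\<close> can be
  made as large as desired.\<close>

lemma one_minus_power_le:
  fixes x :: real
  assumes "0 < x" "x \<le> 1" "0 < b"
  shows "(1 - x) ^ b \<le> 1 / (b * x)"
proof -
  have "(1 - x) ^ b * (1 + x) ^ b \<le> 1"
    unfolding power_mult_distrib[symmetric] using assms
    by (intro power_le_one) (auto simp: algebra_simps mult_le_one)
  moreover have "b * x \<le> (1 + x) ^ b"
    using Bernoulli_inequality[of x b] assms by simp
  ultimately have "(1 - x) ^ b * (b * x) \<le> 1"
    using assms by (meson mult_left_mono order_trans zero_le_power diff_ge_0_iff_ge)
  then show ?thesis using assms by (simp add: field_simps)
qed

text \<open>Each regrouping lowers the entropy rate \<open>i / (2 * K)\<close> of the alphabet by \<open>1 / (2 * K)\<close>, using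
  \<open>b \<approx> 2 ^ (2 * h)\<close> and \<open>d = 2 ^ (i * h - 1)\<close>; the factor \<open>1/2\<close> in \<open>d\<close> leaves room for the choice of
  the \<open>d\<close> blocks once \<open>k\<close> is large.\<close>

lemma hittable_rate:
  assumes "0 < \<epsilon>" "1 \<le> K"
  shows "\<exists>h0. \<forall>h\<ge>h0. hittable K J \<epsilon> (2 * K * h) (2 ^ (Suc i * h))"
  using assms(1)
proof (induction i arbitrary: J \<epsilon>)
  case 0
  have "hittable K J \<epsilon> (2 * K * h) (2 ^ (Suc 0 * h))" if "J + 1 \<le> h" for h
  proof (rule hittable_small_alphabet)
    have "J + 1 \<le> 2 ^ h" using that less_exp[of h] by linarith
    then have "J + 2 ^ h \<le> 2 ^ h * 2 ^ h"
    proof -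
      have "J + 2 ^ h \<le> J * 2 ^ h + 1 * 2 ^ h" by simp
      also have "\<dots> = (J + 1) * 2 ^ h" by (simp only: add_mult_distrib)
      also have "\<dots> \<le> 2 ^ h * 2 ^ h" using \<open>J + 1 \<le> 2 ^ h\<close> by (rule mult_right_mono) simp
      finally show ?thesis .
    qed
    then have "(J + 2 ^ h) ^ K \<le> (2 ^ h * 2 ^ h) ^ K" by (rule power_mono) simp
    also have "\<dots> = 2 ^ (2 * K * h)"
      by (simp add: power_mult[symmetric] power_add[symmetric] mult_2 algebra_simps)
    finally show "(J + 2 ^ (Suc 0 * h)) ^ K \<le> 2 ^ (2 * K * h)" by simp
  qed (use 0 in simp)
  then show ?case by blast
next
  case (Suc i)
  \<comment> \<open>The failure bound will be \<open>2 ^ (h + 1) / b\<close> with \<open>b\<close>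
    at least half of \<open>2 ^ (2 * h)\<close>, hence at most \<open>4 / 2 ^ h\<close>; this is
    below \<open>\<epsilon> / 2\<close> once \<open>2 ^ h \<ge> 8 / \<epsilon>\<close>.\<close>
  obtain g :: nat where g: "8 / \<epsilon> \<le> g" using real_arch_simple by blast
  have "hittable K J \<epsilon> (2 * K * h) (2 ^ (Suc (Suc i) * h))" if h: "J + g + 1 \<le> h" for h
  proof -
    have h2: "J + g + 1 \<le> 2 ^ h" using h less_exp[of h] by linarith
    \<comment> \<open>Subtracting \<open>J\<close> makes \<open>J + b\<close> equal to
      \<open>2 ^ (2 * h)\<close>, whose \<open>K\<close>-th power is exactly 2 to the block length.
      The ratio \<open>v / d\<close> is \<open>2 ^ (h + 1)\<close>.\<close>
    define d v b where "d = (2::nat) ^ (Suc i * h - 1)" and "v = (2::nat) ^ (Suc (Suc i) * h)"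
      and "b = 2 ^ (2 * h) - J"
    have h1: "1 \<le> h" using h by simp
    have sq: "(2::nat) ^ (2 * h) = 2 ^ h * 2 ^ h" by (simp add: mult_2 power_add)
    have two: "(2::nat) \<le> 2 ^ h" using h1 self_le_power[of "2::nat" h] by simp
    have Jb: "2 * J \<le> 2 ^ (2 * h)"
      unfolding sq using h2 two by (intro mult_le_mono) auto
    have b2: "2 ^ (2 * h) \<le> 2 * b" using Jb by (simp add: b_def)
    have J_b: "J + b = 2 ^ (2 * h)" using Jb by (simp add: b_def)
    obtain h0 where h0: "\<And>h. h0 \<le> h \<Longrightarrow> hittable K (J + b) (\<epsilon> / 2) (2 * K * h) (2 ^ (Suc i * h))"
      using Suc.IH[of "\<epsilon> / 2" "J + b"] Suc.prems by auto
    \<comment> \<open>The first summand gives \<open>v ^ d \<le> 2 ^ k\<close>, which the factor 1/2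
      in \<open>d\<close> absorbs \<open>k\<close> times over in \<open>d ^ k\<close>. Adding
      \<open>h0\<close> makes \<open>h * k\<close> admissible for the induction hypothesis, whose
      threshold depends on \<open>J + b\<close> and so on \<open>h\<close>.\<close>
    define k where "k = Suc (Suc i) * h * d + h0 + 1"
    have "hittable K J (\<epsilon> / 2 + \<epsilon> / 2) (2 * K * h) v"
    proof (rule hittable_regroup)
      show "0 < v" "1 \<le> k" "0 \<le> \<epsilon> / 2" "0 \<le> \<epsilon> / 2" using Suc.prems by (auto simp: v_def k_def)
      show "(J + b) ^ K \<le> 2 ^ (2 * K * h)"
        unfolding J_b by (simp add: power_mult[symmetric] algebra_simps)
      have v_d: "v = d * 2 ^ (h + 1)"
      proof -
        have "Suc (Suc i) * h = (Suc i * h - 1) + (h + 1)" using h1 by (simp add: algebra_simps)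
        then show ?thesis unfolding v_def d_def by (simp only: power_add)
      qed
      have dv: "real d / v = 1 / 2 ^ (h + 1)"
        unfolding v_d by (simp add: d_def)
      have "0 < b" using b2 by (intro gr0I) auto
      have "(1 - real d / v) ^ b \<le> 1 / (b * (1 / 2 ^ (h + 1)))"
        unfolding dv by (rule one_minus_power_le) (use \<open>0 < b\<close> one_le_power[of "2 :: real" "Suc h"] in auto)
      also have "\<dots> = 2 ^ (h + 1) / b" by simp
      also have "\<dots> \<le> \<epsilon> / 2"
      proof -
        have "8 \<le> \<epsilon> * g" using g Suc.prems by (simp add: field_simps)
        also have "real g \<le> real (2 ^ h)" using h2 by (simp only: of_nat_le_iff)
        then have "\<epsilon> * g \<le> \<epsilon> * 2 ^ h"
          using Suc.prems by (intro mult_left_mono) auto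
        finally have "8 * 2 ^ h \<le> \<epsilon> * 2 ^ h * 2 ^ h" by (intro mult_right_mono) auto
        moreover have "real (2 ^ h * 2 ^ h) \<le> real (2 * b)"
          using b2 unfolding sq by (simp only: of_nat_le_iff)
        then have "\<epsilon> * (2 ^ h * 2 ^ h) \<le> \<epsilon> * (2 * real b)"
          using Suc.prems by (intro mult_left_mono) auto
        ultimately have "8 * 2 ^ h \<le> \<epsilon> * (2 * real b)"
          unfolding mult.assoc by (rule order_trans)
        then show ?thesis using \<open>0 < b\<close> by (simp add: field_simps)
      qed
      finally show "(1 - real d / v) ^ b \<le> \<epsilon> / 2" .
      have "v ^ d * d ^ k \<le> 2 ^ (Suc i * (h * k))"
      proof -
        have "v ^ d * d ^ k = 2 ^ (Suc (Suc i) * h * d + (Suc i * h - 1) * k)"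
          unfolding v_def d_def by (simp only: power_mult power_add)
        also have "\<dots> \<le> 2 ^ (Suc i * (h * k))"
        proof (rule power_increasing)
          have "Suc (Suc i) * h * d + (Suc i * h - 1) * k \<le> 1 * k + (Suc i * h - 1) * k"
            by (simp add: k_def)
          also have "\<dots> = (1 + (Suc i * h - 1)) * k" by (simp only: add_mult_distrib)
          also have "1 + (Suc i * h - 1) = Suc i * h" using h1 by simp
          finally show "Suc (Suc i) * h * d + (Suc i * h - 1) * k \<le> Suc i * (h * k)"
            unfolding mult.assoc .
        qed simp
        finally show ?thesis .
      qed
      moreover have "h0 \<le> h * k"
        using mult_le_mono[OF h1, of h0 k] by (simp add: k_def)
      ultimately show "hittable K (J + b) (\<epsilon> / 2) (2 * K * h * k) (v ^ d * d ^ k)"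
        using h0[of "h * k"] by (auto simp: mult.assoc intro: hittable_mono)
    qed
    then show ?thesis by (simp add: v_def)
  qed
  then show ?case by blast
qed

text \<open>With \<open>i = 2 * K - 1\<close> the alphabet size \<open>2 ^ (Suc i * h)\<close> is
  the number of all strings of the block length, so the condition on the blocks disappears.\<close>

lemma sparse_hitting_list:
  fixes K :: nat and \<epsilon> :: real
  assumes "0 < \<epsilon>" "1 \<le> K"
  shows "\<exists>N. \<forall>X (s :: nat \<Rightarrow> nat \<Rightarrow> bool). finite X \<longrightarrow>
     (\<exists>F. sparse_list K J F \<and> real (card {x \<in> X. \<not> meets N F (s x)}) \<le> \<epsilon> * card X)"
proof -
  obtain h where "hittable K J \<epsilon> (2 * K * h) (2 ^ (Suc (2 * K - 1) * h))"
    using hittable_rate[OF assms, of J "2 * K - 1"] by blast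
  then have "hittable K J \<epsilon> (2 * K * h) (card {u :: bool list. length u = 2 * K * h})"
    using assms(2) by (simp add: card_strings)
  from this[unfolded hittable_def]
  obtain N where N: "\<forall>V X (s :: nat \<Rightarrow> nat \<Rightarrow> bool).
     V \<subseteq> {u. length u = 2 * K * h} \<and> card V \<le> card {u :: bool list. length u = 2 * K * h} \<and> finite X \<and>
     (\<forall>x\<in>X. \<forall>q. (q + 1) * (2 * K * h) \<le> N \<longrightarrow> substr (s x) (q * (2 * K * h)) (2 * K * h) \<in> V) \<longrightarrow>
     (\<exists>F. sparse_list K J F \<and> real (card {x \<in> X. \<not> meets N F (s x)}) \<le> \<epsilon> * card X)" ..
  show ?thesis
  proof (intro exI[of _ N] allI impI)
    fix X :: "nat set" and s :: "nat \<Rightarrow> nat \<Rightarrow> bool"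
    assume "finite X"
    then show "\<exists>F. sparse_list K J F \<and> real (card {x \<in> X. \<not> meets N F (s x)}) \<le> \<epsilon> * card X"
      using N[THEN spec, of "{u. length u = 2 * K * h}", THEN spec, of X, THEN spec, of s] by simp
  qed
qed

section \<open>Distribution of the output\<close>

text \<open>Isolates the single random bit that a step can inspect, which yields both dependence on
  finitely many bits and measurability.\<close>

lemma pstep_depends: "pstep \<delta> \<rho> c = pstep \<delta> (\<lambda>_. \<rho> (fst (snd c))) c"
  by (cases c) (simp add: Let_def)

lemma pconfig_Suc: "pconfig \<delta> \<rho> (Suc t) = pstep \<delta> \<rho> (pconfig \<delta> \<rho> t)"
  by (simp add: pconfig_def)

lemma pconfig_reads_le: "fst (snd (pconfig \<delta> \<rho> t)) \<le> t"
proof (induction t)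
  case (Suc t)
  have "fst (snd (pstep \<delta> \<rho> c)) \<le> Suc (fst (snd c))" for c
    by (cases c) (simp add: Let_def)
  with Suc show ?case unfolding pconfig_Suc by (meson Suc_le_mono order_trans)
qed (simp add: pconfig_def)

lemma pconfig_cong:
  assumes "\<And>i. i < t \<Longrightarrow> \<rho> i = \<rho>' i"
  shows "pconfig \<delta> \<rho> t = pconfig \<delta> \<rho>' t"
  using assms
proof (induction t)
  case (Suc t)
  then have "pconfig \<delta> \<rho> t = pconfig \<delta> \<rho>' t" by simp
  moreover have "\<rho> (fst (snd (pconfig \<delta> \<rho> t))) = \<rho>' (fst (snd (pconfig \<delta> \<rho> t)))"
    using Suc.prems pconfig_reads_le[of \<delta> \<rho> t] by simp
  ultimately show ?case
    unfolding pconfig_Suc by (subst (1 2) pstep_depends) simp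
qed (simp add: pconfig_def)

lemma poutput_append:
  assumes "t \<le> t'"
  shows "\<exists>ys. poutput \<delta> \<rho> t' = poutput \<delta> \<rho> t @ ys"
  using assms
proof (induction t' rule: dec_induct)
  case (step n)
  have "\<exists>ys. snd (snd (pstep \<delta> \<rho> c)) = snd (snd c) @ ys" for c
    by (cases c) (simp add: Let_def)
  from this[of "pconfig \<delta> \<rho> n"] step.IH show ?case
    unfolding poutput_def pconfig_Suc by force
qed simp

lemma poutput_nth_eq:
  assumes "i < length (poutput \<delta> \<rho> t)" "i < length (poutput \<delta> \<rho> t')"
  shows "poutput \<delta> \<rho> t ! i = poutput \<delta> \<rho> t' ! i"
proof (cases "t \<le> t'")
  case True
  then show ?thesis using poutput_append[OF True, of \<delta> \<rho>] assms by (auto simp: nth_append)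
next
  case False
  then have "t' \<le> t" by simp
  from poutput_append[OF this, of \<delta> \<rho>] show ?thesis using assms by (auto simp: nth_append)
qed

section \<open>The measure on sequences of random bits\<close>

interpretation coin: product_prob_space "\<lambda>_ :: nat. measure_pmf (bernoulli_pmf (1/2))" UNIV
  by unfold_locales

interpretation coin_space: prob_space coin_space
  unfolding coin_space_def by unfold_locales

lemma space_coin_space [simp]: "space coin_space = UNIV"
  by (simp add: coin_space_def space_PiM)

lemma UNIV_in_coin_space [simp]: "UNIV \<in> sets coin_space"
  using sets.top[of coin_space] by simp

lemma measurable_coin: "(\<lambda>\<rho>. \<rho> i) \<in> coin_space \<rightarrow>\<^sub>M count_space UNIV"
proof -
  have "(\<lambda>\<rho>. \<rho> i) \<in> coin_space \<rightarrow>\<^sub>M measure_pmf (bernoulli_pmf (1/2))"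
    unfolding coin_space_def by (rule measurable_component_singleton) simp
  then show ?thesis by simp
qed

lemma measurable_pconfig: "(\<lambda>\<rho>. pconfig \<delta> \<rho> t) \<in> coin_space \<rightarrow>\<^sub>M count_space UNIV"
proof (induction t)
  case 0
  show ?case by (simp add: pconfig_def)
next
  case (Suc t)
  show ?case
    unfolding pconfig_Suc
  \<comment> \<open>Configurations form a countable type, so one configuration \<open>c\<close> can
    be fixed at a time, and then only one coin matters.\<close>
  proof (rule measurable_compose_countable[OF _ Suc])
    fix c
    have "(\<lambda>\<rho>. (\<lambda>b. pstep \<delta> (\<lambda>_. b) c) (\<rho> (fst (snd c)))) \<in> coin_space \<rightarrow>\<^sub>M count_space UNIV"
      by (rule measurable_compose[OF measurable_coin]) simp
    then show "(\<lambda>\<rho>. pstep \<delta> \<rho> c) \<in> coin_space \<rightarrow>\<^sub>M count_space UNIV"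
      by (subst pstep_depends)
  qed
qed

lemma sets_poutput: "{\<rho>. Q (poutput \<delta> \<rho> t)} \<in> sets coin_space"
proof -
  have "(\<lambda>\<rho>. Q (poutput \<delta> \<rho> t)) \<in> coin_space \<rightarrow>\<^sub>M count_space UNIV"
    unfolding poutput_def by (rule measurable_compose[OF measurable_pconfig]) simp
  from measurable_sets[OF this, of "{True}"] show ?thesis by (simp add: vimage_def)
qed

lemma prob_cylinder: "coin_space.prob {\<rho>. \<forall>i<t. \<rho> i = b i} = 1 / 2 ^ t"
proof -
  have "emeasure coin_space {\<rho> \<in> space coin_space. \<forall>i\<in>{..<t}. \<rho> i \<in> {b i}} =
      (\<Prod>i<t. emeasure (measure_pmf (bernoulli_pmf (1/2))) {b i})"
    unfolding coin_space_def by (rule coin.emeasure_PiM_Collect) auto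
  also have "\<dots> = (\<Prod>i<t. ennreal (1/2))"
  proof (rule prod.cong[OF refl])
    fix i show "emeasure (measure_pmf (bernoulli_pmf (1/2))) {b i} = ennreal (1/2)"
      by (cases "b i") (simp_all add: emeasure_pmf_single)
  qed
  also have "\<dots> = ennreal ((1/2) ^ t)"
    unfolding prod_constant card_lessThan by (rule ennreal_power) simp
  finally have "emeasure coin_space {\<rho>. \<forall>i<t. \<rho> i = b i} = ennreal ((1/2) ^ t)"
    by (simp add: Ball_def)
  then show ?thesis by (simp add: measure_def power_one_over)
qed

lemma bits_ext:
  assumes "r < 2 ^ t" "r' < 2 ^ t" "\<And>i. i < t \<Longrightarrow> bits r i = bits r' i"
  shows "r = r'"
proof (rule bit_eqI)
  fix i :: nat
  have *: "\<not> bit x i" if "x < 2 ^ t" "t \<le> i" for x :: nat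
  proof -
    have "x < 2 ^ i" using that by (meson one_le_numeral order_less_le_trans power_increasing)
    then show ?thesis by (simp add: bit_iff_odd)
  qed
  show "bit r i \<longleftrightarrow> bit r' i"
    using assms *[of r] *[of r'] by (cases "i < t") (auto simp: bits_def bit_iff_odd)
qed

lemma bits_surj: "\<exists>r<2 ^ t. \<forall>i<t. \<rho> i = bits r i"
proof (intro exI conjI allI impI)
  let ?r = "horner_sum of_bool 2 (map \<rho> [0..<t]) :: nat"
  show "?r < 2 ^ t" using low_less[of "map \<rho> [0..<t]"] by simp
  fix i assume "i < t"
  then show "\<rho> i = bits ?r i"
    by (simp add: bits_def flip: bit_iff_odd) (simp add: bit_horner_sum_bit_iff)
qed

text \<open>By time \<open>t\<close> at most \<open>t\<close> random bits have been read, so the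
  output is constant on each of the \<open>2 ^ t\<close> cylinders, which are indexed by the numbers
  \<open>r < 2 ^ t\<close>. This identifies the counting in \<open>hits\<close> with a
  probability.\<close>

lemma prob_poutput:
  "coin_space.prob {\<rho>. Q (poutput \<delta> \<rho> t)} = card {r. r < 2 ^ t \<and> Q (poutput \<delta> (bits r) t)} / 2 ^ t"
proof -
  let ?R = "{r. r < 2 ^ t \<and> Q (poutput \<delta> (bits r) t)}"
  let ?C = "\<lambda>r. {\<rho>. \<forall>i<t. \<rho> i = bits r i}"
  have out: "poutput \<delta> \<rho> t = poutput \<delta> (bits r) t" if "\<rho> \<in> ?C r" for \<rho> r
    unfolding poutput_def using that by (subst pconfig_cong[of t \<rho> "bits r"]) auto
  have "{\<rho>. Q (poutput \<delta> \<rho> t)} = (\<Union>r\<in>?R. ?C r)"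
  proof (intro set_eqI iffI)
    fix \<rho> assume Q: "\<rho> \<in> {\<rho>. Q (poutput \<delta> \<rho> t)}"
    obtain r where r: "r < 2 ^ t" "\<rho> \<in> ?C r" using bits_surj[of t \<rho>] by blast
    with Q out[OF r(2)] show "\<rho> \<in> (\<Union>r\<in>?R. ?C r)" by auto
  next
    fix \<rho> assume "\<rho> \<in> (\<Union>r\<in>?R. ?C r)"
    then obtain r where "r \<in> ?R" "\<rho> \<in> ?C r" by blast
    with out[OF this(2)] show "\<rho> \<in> {\<rho>. Q (poutput \<delta> \<rho> t)}" by simp
  qed
  moreover have "coin_space.prob (\<Union>r\<in>?R. ?C r) = (\<Sum>r\<in>?R. coin_space.prob (?C r))"
  proof (rule coin_space.finite_measure_finite_Union)
    have "?C r \<in> sets coin_space" for r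
    proof -
      have "?C r = (\<Inter>i\<in>{..<t}. {\<rho>. \<rho> i = bits r i}) \<inter> space coin_space" by auto
      also have "\<dots> \<in> sets coin_space"
      proof (cases "t = 0")
        case False
        have "{\<rho>. \<rho> i = bits r i} \<in> sets coin_space" for i
          using measurable_sets[OF measurable_coin, of "{bits r i}" i] by (simp add: vimage_def)
        then show ?thesis using False by (intro sets.Int sets.finite_INT) auto
      qed simp
      finally show ?thesis .
    qed
    then show "?C ` ?R \<subseteq> sets coin_space" by blast
    show "disjoint_family_on ?C ?R"
      unfolding disjoint_family_on_def
    proof (intro ballI impI)
      fix r r' assume r: "r \<in> ?R" "r' \<in> ?R" "r \<noteq> r'"
      show "?C r \<inter> ?C r' = {}"
      proof (rule ccontr)
        assume "?C r \<inter> ?C r' \<noteq> {}"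
        then obtain \<rho> where "\<And>i. i < t \<Longrightarrow> bits r i = \<rho> i" "\<And>i. i < t \<Longrightarrow> bits r' i = \<rho> i" by auto
        with bits_ext[of r t r'] r show False by simp
      qed
    qed
  qed simp
  ultimately show ?thesis by (simp add: prob_cylinder)
qed

section \<open>Events of long, infinite and complex output\<close>

definition long_output :: "(nat \<Rightarrow> nat) \<Rightarrow> nat \<Rightarrow> nat \<Rightarrow> (nat \<Rightarrow> bool) set" where
  "long_output \<delta> N t = {\<rho>. N \<le> length (poutput \<delta> \<rho> t)}"

definition infinite_output :: "(nat \<Rightarrow> nat) \<Rightarrow> (nat \<Rightarrow> bool) set" where
  "infinite_output \<delta> = (\<Inter>N. \<Union>t. long_output \<delta> N t)"

text \<open>Speaking of factors of finite outputs makes this a countable intersection of measurable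
  events, and natural parameters turn the union over all of them into a countable one.\<close>

definition complex_output ::
  "(nat \<Rightarrow> nat) \<Rightarrow> (bool list \<Rightarrow> bool list option) \<Rightarrow> nat \<Rightarrow> nat \<Rightarrow> (nat \<Rightarrow> bool) set" where
  "complex_output \<delta> U a c = infinite_output \<delta> \<inter>
     (\<Inter>t. {\<rho>. \<forall>f. sublist f (poutput \<delta> \<rho> t) \<longrightarrow> length f \<le> a * KC U f + c})"

lemma sets_long_output [measurable]: "long_output \<delta> N t \<in> sets coin_space"
  unfolding long_output_def by (rule sets_poutput)

lemma sets_infinite_output [measurable]: "infinite_output \<delta> \<in> sets coin_space"
  unfolding infinite_output_def by measurable

lemma sets_complex_output [measurable]: "complex_output \<delta> U a c \<in> sets coin_space"
  unfolding complex_output_def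
  by (intro sets.Int sets_infinite_output sets.countable_INT'' sets_poutput) simp_all

lemma incseq_long_output: "incseq (long_output \<delta> N)"
proof (rule incseq_SucI)
  fix t
  have "length (poutput \<delta> \<rho> t) \<le> length (poutput \<delta> \<rho> (Suc t))" for \<rho>
    using poutput_append[of t "Suc t" \<delta> \<rho>] by auto
  then show "long_output \<delta> N t \<le> long_output \<delta> N (Suc t)"
    unfolding long_output_def by (auto intro: order_trans)
qed

lemma decseq_long_output: "decseq (\<lambda>N. \<Union>t. long_output \<delta> N t)"
  unfolding long_output_def by (rule decseq_SucI) (auto dest: Suc_leD)

text \<open>One \<open>\<epsilon>\<close> pays for infinite outputs that are still shorter than
  \<open>N\<close> at time \<open>t\<close>, the other for long outputs missed by \<open>F\<close>.
  The distribution given to \<open>sparse_hitting_list\<close> is uniform on the random strings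
  \<open>r\<close> with long output.\<close>

lemma exists_hits:
  assumes "0 < \<epsilon>" "1 \<le> K" "x \<le> q * (coin_space.prob (infinite_output \<delta>) - 2 * \<epsilon>)"
  shows "\<exists>t F. hits \<delta> K x q m t F"
proof -
  obtain N where N: "\<And>X (s :: nat \<Rightarrow> nat \<Rightarrow> bool). finite X \<Longrightarrow>
     (\<exists>F. sparse_list K m F \<and> real (card {x \<in> X. \<not> meets N F (s x)}) \<le> \<epsilon> * card X)"
    using sparse_hitting_list[OF assms(1,2), of m] by blast
  let ?p = "coin_space.prob (infinite_output \<delta>)"
  have "(\<lambda>t. coin_space.prob (long_output \<delta> N t)) \<longlonglongrightarrow> coin_space.prob (\<Union>t. long_output \<delta> N t)"
    by (rule coin_space.finite_Lim_measure_incseq[OF _ incseq_long_output]) auto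
  moreover have "?p - \<epsilon> < coin_space.prob (\<Union>t. long_output \<delta> N t)"
  proof -
    have "?p \<le> coin_space.prob (\<Union>t. long_output \<delta> N t)"
      by (rule coin_space.finite_measure_mono) (auto simp: infinite_output_def)
    with assms(1) show ?thesis by simp
  qed
  ultimately have "eventually (\<lambda>t. ?p - \<epsilon> < coin_space.prob (long_output \<delta> N t)) sequentially"
    by (rule order_tendstoD(1))
  then obtain t where t: "?p - \<epsilon> < coin_space.prob (long_output \<delta> N t)"
    unfolding eventually_sequentially by blast
  define X where "X = {r. r < 2 ^ t \<and> N \<le> length (poutput \<delta> (bits r) t)}"
  \<comment> \<open>Values beyond the end of the output are arbitrary; \<open>meets N\<close>
    inspects only the first \<open>N\<close> positions, which exist for \<open>r\<close> in
    \<open>X\<close>.\<close>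
  define s where "s r i = poutput \<delta> (bits r) t ! i" for r i
  have finX: "finite X" and X_le: "card X \<le> 2 ^ t"
    using card_mono[of "{..<2 ^ t}" X] by (auto simp: X_def)
  have "?p - \<epsilon> \<le> card X / 2 ^ t"
    using t unfolding long_output_def X_def by (subst (asm) prob_poutput) simp
  then have X_ge: "(?p - \<epsilon>) * 2 ^ t \<le> card X" by (simp add: field_simps)
  obtain F where F: "sparse_list K m F" "real (card {r \<in> X. \<not> meets N F (s r)}) \<le> \<epsilon> * card X"
    using N[OF finX] by blast
  let ?H = "{r. r < 2 ^ t \<and> (\<exists>f\<in>set F. sublist f (poutput \<delta> (bits r) t))}"
  have meets: "r \<in> ?H" if r: "r \<in> X" "meets N F (s r)" for r
  proof -
    obtain f k where f: "f \<in> set F" "k + length f \<le> N" "substr (s r) k (length f) = f"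
      using r(2) unfolding meets_def by blast
    have len: "k + length f \<le> length (poutput \<delta> (bits r) t)" using f(2) r(1) by (simp add: X_def)
    have "take (length f) (drop k (poutput \<delta> (bits r) t)) = substr (s r) k (length f)"
      using len by (intro nth_equalityI) (auto simp: substr_def s_def)
    then have "f = take (length f) (drop k (poutput \<delta> (bits r) t))" using f(3) by simp
    then have "sublist f (poutput \<delta> (bits r) t)"
      by (metis sublist_take sublist_drop sublist_order.order_trans)
    with f(1) r(1) show ?thesis by (auto simp: X_def)
  qed
  have "card X \<le> card (?H \<union> {r \<in> X. \<not> meets N F (s r)})"
    using meets finX by (intro card_mono) auto
  also have "\<dots> \<le> card ?H + card {r \<in> X. \<not> meets N F (s r)}" by (rule card_Un_le)
  finally have "real (card X) \<le> card ?H + \<epsilon> * card X" using F(2) by simp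
  also have "\<epsilon> * card X \<le> \<epsilon> * 2 ^ t"
  proof -
    have "real (card X) \<le> real (2 ^ t)" using X_le by (simp only: of_nat_le_iff)
    then show ?thesis using assms(1) by (intro mult_left_mono) auto
  qed
  finally have "(?p - 2 * \<epsilon>) * 2 ^ t \<le> card ?H"
    using X_ge by (simp add: algebra_simps)
  then have "q * ((?p - 2 * \<epsilon>) * 2 ^ t) \<le> q * real (card ?H)"
    by (rule mult_left_mono) simp
  moreover have "real x * 2 ^ t \<le> q * ((?p - 2 * \<epsilon>) * 2 ^ t)"
    unfolding mult.assoc[symmetric] using assms(3) by (intro mult_right_mono) auto
  ultimately have "real x * 2 ^ t \<le> q * real (card ?H)"
    by (rule order_trans[rotated])
  then have "real (x * 2 ^ t) \<le> real (q * card ?H)" by simp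
  then have "x * 2 ^ t \<le> q * card ?H" by (simp only: of_nat_le_iff)
  moreover have "(m + j + 1) ^ K \<le> num (F ! j)" if "j < length F" for j
    using F(1) that num_ge[of "F ! j"] unfolding sparse_list_def by (meson order_trans)
  ultimately have "hits \<delta> K x q m t F" unfolding hits_def by blast
  then show ?thesis by blast
qed

lemma KC_le: "D p = Some u \<Longrightarrow> KC D u \<le> length p"
  unfolding KC_def by (rule Least_le) blast

lemma prob_complex_output:
  assumes U: "optimal_decompressor U" and \<delta>: "computable \<delta>" and "1 \<le> a"
  shows "coin_space.prob (complex_output \<delta> U a c) = 0"
proof -
  let ?p = "coin_space.prob (infinite_output \<delta>)"
  let ?S = "complex_output \<delta> U a c"
  have S_inf: "?S \<subseteq> infinite_output \<delta>" by (auto simp: complex_output_def)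
  have bound: "coin_space.prob ?S \<le> 4 * \<epsilon>" if pos: "0 < \<epsilon>" for \<epsilon>
  proof (cases "?p \<le> 2 * \<epsilon>")
    case True
    have "coin_space.prob ?S \<le> ?p"
      using S_inf by (rule coin_space.finite_measure_mono) simp
    with True pos show ?thesis by linarith
  next
    case False
    define K where "K = 4 * a"
    obtain q :: nat where q: "1 / \<epsilon> \<le> q" using real_arch_simple by blast
    have "0 < 1 / \<epsilon>" using pos by simp
    then have q0: "0 < real q" using q by linarith
    have q1: "1 \<le> \<epsilon> * q" using q pos by (simp add: field_simps)
    \<comment> \<open>Rounding down loses at most 1, and \<open>1 \<le> \<epsilon> * q\<close> by
      the choice of \<open>q\<close>: a third \<open>\<epsilon>\<close>.\<close>
    define x where "x = nat \<lfloor>q * (?p - 2 * \<epsilon>)\<rfloor>"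
    have nonneg: "0 \<le> q * (?p - 2 * \<epsilon>)" using False by simp
    then have x: "real x \<le> q * (?p - 2 * \<epsilon>)" "q * (?p - 2 * \<epsilon>) - 1 \<le> x"
      unfolding x_def by linarith+
    obtain E where E: "decompressor E" "\<And>m t F. hits \<delta> K x q m t F \<Longrightarrow>
      (\<exists>t F. hits \<delta> K x q m t F \<and>
        (\<forall>j<length F. \<exists>p. 2 ^ length p \<le> (m + j + 1) ^ 2 \<and> E p = Some (F ! j)))"
      using hitting_decompressor[OF \<delta>, of K x q] by blast
    obtain e where e: "\<And>p u. E p = Some u \<Longrightarrow> \<exists>q. U q = Some u \<and> length q \<le> length p + e"
      using U E(1) unfolding optimal_decompressor_def by blast
    have "(\<lambda>N. coin_space.prob (\<Union>t. long_output \<delta> N t)) \<longlonglongrightarrow> ?p"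
      unfolding infinite_output_def
      by (rule coin_space.finite_Lim_measure_decseq[OF _ decseq_long_output]) auto
    then have "eventually (\<lambda>N. coin_space.prob (\<Union>t. long_output \<delta> N t) < ?p + \<epsilon>) sequentially"
      using pos by (intro order_tendstoD(2)) auto
    then obtain N where N: "coin_space.prob (\<Union>t. long_output \<delta> N t) < ?p + \<epsilon>"
      unfolding eventually_sequentially by blast
    \<comment> \<open>Members of \<open>F\<close> will have length at least \<open>M\<close>: the
      summand \<open>N\<close> forces long outputs, and the rest makes half the length exceed
      \<open>a * e + c\<close>.\<close>
    define M where "M = N + 2 * (a * e + c) + 1"
    have "1 \<le> K" using \<open>1 \<le> a\<close> by (simp add: K_def)
    from exists_hits[OF pos this x(1)]
    obtain t0 F0 where "hits \<delta> K x q (2 ^ M) t0 F0" by blast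
    from E(2)[OF this] obtain t F where hit: "hits \<delta> K x q (2 ^ M) t F" and
      short: "\<And>j. j < length F \<Longrightarrow> \<exists>p. 2 ^ length p \<le> (2 ^ M + j + 1) ^ 2 \<and> E p = Some (F ! j)"
      by blast
    have pow: "(2 ^ M + j + 1) ^ K < 2 ^ Suc (length (F ! j))" if "j < length F" for j
      using hit that num_less[of "F ! j"] unfolding hits_def by (meson le_less_trans)
    have long: "M \<le> length (F ! j)" if "j < length F" for j
    proof -
      have "(2::nat) ^ M \<le> 2 ^ M + j + 1" by simp
      also have "\<dots> \<le> (2 ^ M + j + 1) ^ K" using \<open>1 \<le> K\<close> by (intro self_le_power) auto
      finally have "(2::nat) ^ M < 2 ^ Suc (length (F ! j))" using pow[OF that] by linarith
      then have "M < Suc (length (F ! j))" by (rule power_less_imp_less_exp[rotated]) simp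
      then show ?thesis by simp
    qed
    have simple: "a * KC U (F ! j) + c < length (F ! j)" if j: "j < length F" for j
    proof -
      obtain p where p: "2 ^ length p \<le> (2 ^ M + j + 1) ^ 2" "E p = Some (F ! j)"
        using short[OF j] by blast
      have "(2::nat) ^ (length p * (2 * a)) \<le> ((2 ^ M + j + 1) ^ 2) ^ (2 * a)"
        unfolding power_mult[of _ "length p"] using p(1) by (rule power_mono) simp
      also have "\<dots> = (2 ^ M + j + 1) ^ K" by (simp add: K_def flip: power_mult)
      finally have "(2::nat) ^ (length p * (2 * a)) < 2 ^ Suc (length (F ! j))" using pow[OF j] by linarith
      then have "length p * (2 * a) < Suc (length (F ! j))" by (rule power_less_imp_less_exp[rotated]) simp
      moreover obtain q where "U q = Some (F ! j)" "length q \<le> length p + e" using e[OF p(2)] by blast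
      then have "KC U (F ! j) \<le> length p + e" using KC_le by (meson order_trans)
      then have "a * KC U (F ! j) \<le> a * (length p + e)" by (rule mult_le_mono2)
      ultimately show ?thesis using long[OF j] by (simp add: M_def algebra_simps)
    qed
    let ?H = "{\<rho>. \<exists>f\<in>set F. sublist f (poutput \<delta> \<rho> t)}"
    have H_sets: "?H \<in> sets coin_space" by (rule sets_poutput)
    have "x * 2 ^ t \<le> q * card {r. r < 2 ^ t \<and> (\<exists>f\<in>set F. sublist f (poutput \<delta> (bits r) t))}"
      using hit unfolding hits_def by blast
    then have "real (x * 2 ^ t) \<le> real (q * card {r. r < 2 ^ t \<and> (\<exists>f\<in>set F. sublist f (poutput \<delta> (bits r) t))})"
      by (simp only: of_nat_le_iff)
    then have "x \<le> q * coin_space.prob ?H"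
      unfolding prob_poutput[of "\<lambda>y. \<exists>f\<in>set F. sublist f y"] by (simp add: field_simps)
    then have "q * (?p - 3 * \<epsilon>) \<le> q * coin_space.prob ?H"
      using x(2) q1 by (simp add: algebra_simps)
    then have H_ge: "?p - 3 * \<epsilon> \<le> coin_space.prob ?H" using q0 by simp
    have "?S \<inter> ?H = {}"
    proof (rule ccontr)
      assume "?S \<inter> ?H \<noteq> {}"
      then obtain \<rho> j where "\<rho> \<in> ?S" "j < length F" "sublist (F ! j) (poutput \<delta> \<rho> t)"
        by (auto simp: in_set_conv_nth)
      then have "length (F ! j) \<le> a * KC U (F ! j) + c" unfolding complex_output_def by blast
      with simple[OF \<open>j < length F\<close>] show False by simp
    qed
    \<comment> \<open>Two disjoint events inside one of probability below
      \<open>?p + \<epsilon>\<close>; the second has probability at least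
      \<open>?p - 3 * \<epsilon>\<close>, which leaves \<open>4 * \<epsilon>\<close> for the
      first.\<close>
    then have "coin_space.prob ?S + coin_space.prob ?H = coin_space.prob (?S \<union> ?H)"
      using H_sets by (simp add: coin_space.finite_measure_Union)
    also have "\<dots> \<le> coin_space.prob (\<Union>t. long_output \<delta> N t)"
    proof (rule coin_space.finite_measure_mono)
      have "?H \<subseteq> long_output \<delta> N t"
      proof
        fix \<rho> assume "\<rho> \<in> ?H"
        then obtain j where j: "j < length F" "sublist (F ! j) (poutput \<delta> \<rho> t)" by (auto simp: in_set_conv_nth)
        then have "length (F ! j) \<le> length (poutput \<delta> \<rho> t)" by (simp add: sublist_length_le)
        with long[OF j(1)] show "\<rho> \<in> long_output \<delta> N t" by (simp add: long_output_def M_def)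
      qed
      then show "?S \<union> ?H \<subseteq> (\<Union>t. long_output \<delta> N t)" using S_inf by (auto simp: infinite_output_def)
    qed auto
    finally show ?thesis using H_ge N by linarith
  qed
  have "coin_space.prob ?S \<le> 0"
  proof (rule field_le_epsilon)
    fix \<epsilon> :: real assume "0 < \<epsilon>"
    with bound[of "\<epsilon> / 4"] show "coin_space.prob ?S \<le> 0 + \<epsilon>" by simp
  qed
  then show ?thesis using measure_nonneg[of coin_space ?S] by linarith
qed

section \<open>From finite outputs to the produced sequence\<close>

lemma produces_infinite_output:
  "(\<exists>\<omega>. produces \<delta> \<rho> \<omega>) \<longleftrightarrow> \<rho> \<in> infinite_output \<delta>"
proof
  assume "\<exists>\<omega>. produces \<delta> \<rho> \<omega>"
  then show "\<rho> \<in> infinite_output \<delta>"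
    unfolding produces_def infinite_output_def long_output_def using less_imp_le by blast
next
  assume inf: "\<rho> \<in> infinite_output \<delta>"
  have "\<exists>t. n < length (poutput \<delta> \<rho> t)" for n
    using inf unfolding infinite_output_def long_output_def Suc_le_eq[symmetric] by blast
  then obtain T where "\<And>n. n < length (poutput \<delta> \<rho> (T n))" by metis
  then have "produces \<delta> \<rho> (\<lambda>n. poutput \<delta> \<rho> (T n) ! n)" unfolding produces_def by blast
  then show "\<exists>\<omega>. produces \<delta> \<rho> \<omega>" by blast
qed

lemma sublist_poutput:
  assumes "produces \<delta> \<rho> \<omega>"
  shows "(\<exists>t. sublist f (poutput \<delta> \<rho> t)) \<longleftrightarrow> (\<exists>k. f = substr \<omega> k (length f))"
proof -
  have nth: "poutput \<delta> \<rho> t ! i = \<omega> i" if "i < length (poutput \<delta> \<rho> t)" for t i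
    using assms that poutput_nth_eq unfolding produces_def by metis
  have slice: "substr \<omega> k n = take n (drop k (poutput \<delta> \<rho> t))" if "k + n \<le> length (poutput \<delta> \<rho> t)" for k n t
    using that by (intro nth_equalityI) (auto simp: substr_def nth)
  show ?thesis
  proof
    assume "\<exists>t. sublist f (poutput \<delta> \<rho> t)"
    then obtain t u v where ys: "poutput \<delta> \<rho> t = u @ f @ v" by (auto simp: sublist_def)
    have "substr \<omega> (length u) (length f) = f" by (subst slice[of _ _ t]) (simp_all add: ys)
    then show "\<exists>k. f = substr \<omega> k (length f)" by metis
  next
    assume "\<exists>k. f = substr \<omega> k (length f)"
    then obtain k where k: "f = substr \<omega> k (length f)" by blast
    obtain t where "k + length f < length (poutput \<delta> \<rho> t)"
      using assms unfolding produces_def by blast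
    then have "f = take (length f) (drop k (poutput \<delta> \<rho> t))" using k slice[of k "length f" t] by simp
    then have "sublist f (poutput \<delta> \<rho> t)"
      by (metis sublist_take sublist_drop sublist_order.order_trans)
    then show "\<exists>t. sublist f (poutput \<delta> \<rho> t)" by blast
  qed
qed

lemma complex_output_iff:
  assumes "produces \<delta> \<rho> \<omega>"
  shows "\<rho> \<in> complex_output \<delta> U a c \<longleftrightarrow> (\<forall>k n. n \<le> a * KC U (substr \<omega> k n) + c)"
proof -
  have "\<rho> \<in> infinite_output \<delta>" using produces_infinite_output assms by blast
  then have "\<rho> \<in> complex_output \<delta> U a c \<longleftrightarrow>
      (\<forall>f. (\<exists>t. sublist f (poutput \<delta> \<rho> t)) \<longrightarrow> length f \<le> a * KC U f + c)"
    unfolding complex_output_def by blast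
  also have "\<dots> \<longleftrightarrow> (\<forall>k n. n \<le> a * KC U (substr \<omega> k n) + c)"
    unfolding sublist_poutput[OF assms] by (metis length_substr)
  finally show ?thesis .
qed

text \<open>Lowering \<open>\<alpha>\<close> weakens the condition up to the constant, so
  reciprocals of integers suffice; \<open>a + 2\<close> ranges over exactly those integers whose
  reciprocal lies strictly between 0 and 1.\<close>

lemma everywhere_complex_iff:
  "(\<exists>\<alpha>::real. 0 < \<alpha> \<and> \<alpha> < 1 \<and> everywhere_complex U \<alpha> \<omega>) \<longleftrightarrow>
   (\<exists>a c. \<forall>k n. n \<le> (a + 2) * KC U (substr \<omega> k n) + c)"
proof
  assume "\<exists>\<alpha>::real. 0 < \<alpha> \<and> \<alpha> < 1 \<and> everywhere_complex U \<alpha> \<omega>"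
  then obtain \<alpha> b where \<alpha>: "0 < \<alpha>" and b: "\<And>k n. \<alpha> * real n - b \<le> real (KC U (substr \<omega> k n))"
    unfolding everywhere_complex_def by auto
  obtain a :: nat where a: "1 / \<alpha> \<le> a" using real_arch_simple by blast
  obtain c :: nat where c: "(a + 2) * b \<le> c" using real_arch_simple by blast
  have "n \<le> (a + 2) * KC U (substr \<omega> k n) + c" for k n
  proof -
    have "1 \<le> (a + 2) * \<alpha>" using a \<alpha> by (simp add: field_simps)
    then have "1 * real n \<le> (a + 2) * \<alpha> * n" by (rule mult_right_mono) simp
    also have "\<dots> = (a + 2) * (\<alpha> * n)" by simp
    also have "\<dots> \<le> (a + 2) * (KC U (substr \<omega> k n) + b)"
      using b[of n k] by (intro mult_left_mono) auto
    also have "\<dots> \<le> (a + 2) * KC U (substr \<omega> k n) + c" using c by (simp add: algebra_simps)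
    finally have "real n \<le> real ((a + 2) * KC U (substr \<omega> k n) + c)" by simp
    then show ?thesis by (simp only: of_nat_le_iff)
  qed
  then show "\<exists>a c. \<forall>k n. n \<le> (a + 2) * KC U (substr \<omega> k n) + c" by blast
next
  assume "\<exists>a c. \<forall>k n. n \<le> (a + 2) * KC U (substr \<omega> k n) + c"
  then obtain a c where ac: "\<And>k n. n \<le> (a + 2) * KC U (substr \<omega> k n) + c" by blast
  have "1 / (a + 2) * real n - c \<le> real (KC U (substr \<omega> k n))" for k n
  proof -
    have "real n \<le> real ((a + 2) * KC U (substr \<omega> k n) + c)"
      using ac[of n k] by (simp only: of_nat_le_iff)
    also have "\<dots> \<le> (a + 2) * (real (KC U (substr \<omega> k n)) + c)" by (simp add: algebra_simps)
    finally show ?thesis by (simp add: field_simps)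
  qed
  then have "everywhere_complex U (1 / (a + 2)) \<omega>" unfolding everywhere_complex_def by blast
  then show "\<exists>\<alpha>::real. 0 < \<alpha> \<and> \<alpha> < 1 \<and> everywhere_complex U \<alpha> \<omega>"
    by (intro exI[of _ "1 / (a + 2)"]) (simp add: field_simps)
qed

theorem theorem1:
  fixes U :: "bool list \<Rightarrow> bool list option" and \<delta> :: "nat \<Rightarrow> nat"
  assumes "optimal_decompressor U"
    and "computable \<delta>"
  shows "{\<rho> \<in> space coin_space. \<exists>\<omega>. produces \<delta> \<rho> \<omega> \<and>
            (\<exists>\<alpha>::real. 0 < \<alpha> \<and> \<alpha> < 1 \<and> everywhere_complex U \<alpha> \<omega>)}
         \<in> null_sets coin_space"
proof -
  \<comment> \<open>Equality, rather than inclusion, also shows that the event is measurable, as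
    membership in \<open>null_sets\<close> requires.\<close>
  have "{\<rho> \<in> space coin_space. \<exists>\<omega>. produces \<delta> \<rho> \<omega> \<and>
            (\<exists>\<alpha>::real. 0 < \<alpha> \<and> \<alpha> < 1 \<and> everywhere_complex U \<alpha> \<omega>)}
      = (\<Union>a. \<Union>c. complex_output \<delta> U (a + 2) c)" (is "?L = ?R")
  proof (intro set_eqI iffI)
    fix \<rho> assume "\<rho> \<in> ?L"
    then obtain \<omega> where \<omega>: "produces \<delta> \<rho> \<omega>"
      and "\<exists>\<alpha>::real. 0 < \<alpha> \<and> \<alpha> < 1 \<and> everywhere_complex U \<alpha> \<omega>" by blast
    then obtain a c where "\<forall>k n. n \<le> (a + 2) * KC U (substr \<omega> k n) + c"
      unfolding everywhere_complex_iff by blast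
    then have "\<rho> \<in> complex_output \<delta> U (a + 2) c" unfolding complex_output_iff[OF \<omega>] .
    then show "\<rho> \<in> ?R" by blast
  next
    fix \<rho> assume "\<rho> \<in> ?R"
    then obtain a c where R: "\<rho> \<in> complex_output \<delta> U (a + 2) c" by blast
    then have "\<rho> \<in> infinite_output \<delta>" by (simp add: complex_output_def)
    then obtain \<omega> where \<omega>: "produces \<delta> \<rho> \<omega>" using produces_infinite_output by blast
    have "\<exists>\<alpha>::real. 0 < \<alpha> \<and> \<alpha> < 1 \<and> everywhere_complex U \<alpha> \<omega>"
      using R unfolding complex_output_iff[OF \<omega>] everywhere_complex_iff by blast
    with \<omega> show "\<rho> \<in> ?L" by auto
  qed
  also have "\<dots> \<in> null_sets coin_space"
  proof (intro null_sets_UN)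
    fix a c
    have "coin_space.prob (complex_output \<delta> U (a + 2) c) = 0"
      by (rule prob_complex_output[OF assms]) simp
    then show "complex_output \<delta> U (a + 2) c \<in> null_sets coin_space"
      by (intro null_setsI) (simp_all add: coin_space.emeasure_eq_measure)
  qed
  finally show ?thesis .
qed

end
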